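(* Let $M\ge 3$ be an integer and let $\mathcal{A},\mathcal{B}\subset\{0,1,\dots,M-1\}$ with $1<|\mathcal{A}|=|\mathcal{B}|<M$. Put $\delta=\frac{\log|\mathcal{A}|}{\log M}\in(0,1)$. Then the following are equivalent: (1) $\beta(M,\mathcal{A},\mathcal{B})=\frac{1-\delta}{2}$; (2) for all $b_1\neq b_1'$ in $\mathcal{B}$, either $$\widehat{\nu_{\mathcal{A}}}\left(\frac{b_1-b_1'}{M}\right)=0,$$ or $$\widehat{\nu_{\mathcal{A}}}\left(\frac{b_1-b_1'}{M^2}+\frac{b_2-b_2'}{M}\right)=0\quad\text{for all } b_2,b_2'\in\mathcal{B}.$$
   Context: For a nonempty finite set $E\subset\mathbb{R}$, $\nu_E$ is the uniform probability measure on $E$, with Fourier transform $\widehat{\nu_E}(\xi)=\frac{1}{|E|}\sum_{a\in E}e^{-2\pi i\xi a}$ for $\xi\in\mathbb{R}$. For $N\ge1$, $\mathcal{F}_N=\frac{1}{\sqrt N}\left(e^{-2\pi i jl/N}\right)_{0\le j,l\le N-1}$ is the discrete Fourier transform matrix on $\mathbb{C}^{\mathbb{Z}_N}$ ($\mathbb{Z}_N$ is the cyclic group of order $N$). For $E\subset\mathbb{Z}_N$, $\mathbf{1}_E$ also denotes the operator of multiplication by the indicator function of $E$. For $k\ge1$, $\mathcal{A}_k=\left\{\sum_{j=0}^{k-1}a_jM^j: a_j\in\mathcal{A}\right\}\subset\{0,\dots,M^k-1\}$, and $\mathcal{B}_k$ is defined in the same way from $\mathcal{B}$; these are viewed as subsets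 of $\mathbb{Z}_{M^k}$. $\beta(M,\mathcal{A},\mathcal{B})$ is the largest exponent $\beta$, understood as the supremum of all real $\beta$, such that there is a constant $C>0$ independent of $k$ with $$\|\mathbf{1}_{\mathcal{A}_k}\mathcal{F}_{M^k}\mathbf{1}_{\mathcal{B}_k}\|_{\ell^2\to\ell^2}\le C\,M^{-k\beta}\quad\text{for all }k\ge1,$$ where $\|\cdot\|_{\ell^2\to\ell^2}$ is the operator norm with respect to the Euclidean norm. *)

theory Defs
  imports
    "Jordan_Normal_Form.Matrix"
    "HOL-Analysis.L2_Norm"
    "HOL-Library.Indicator_Function"
begin

definition nu_hat :: "real set \<Rightarrow> real \<Rightarrow> complex" where
  "nu_hat E \<xi> = (1 / of_nat (card E)) * (\<Sum>a\<in>E. exp (- 2 * of_real pi * \<i> * of_real \<xi> * of_real a))"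

text \<open>The space of complex functions on the cyclic group of order \<open>N\<close> is
  \<open>carrier_vec N\<close>, with residues represented by their least nonnegative representatives
  \<open>0, \<dots>, N - 1\<close>.\<close>

definition dft_mat :: "nat \<Rightarrow> complex mat" where
  "dft_mat N = mat N N (\<lambda>(j, l).
     (1 / of_real (sqrt (real N))) * exp (- 2 * of_real pi * \<i> * of_nat j * of_nat l / of_nat N))"

definition indicator_mat :: "nat \<Rightarrow> nat set \<Rightarrow> complex mat" where
  "indicator_mat N E = mat_diag N (indicator E)"

definition l2_norm_vec :: "complex vec \<Rightarrow> real" where
  "l2_norm_vec v = L2_set (\<lambda>i. cmod (vec_index v i)) {..<dim_vec v}"

text \<open>The analogue for matrices of variable size of the operator norm \<open>onorm\<close>; the zero
  vector contributes \<open>0 / 0 = 0\<close>.\<close>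

definition l2_op_norm :: "complex mat \<Rightarrow> real" where
  "l2_op_norm T = (SUP v\<in>carrier_vec (dim_col T). l2_norm_vec (T *\<^sub>v v) / l2_norm_vec v)"

definition digit_set :: "nat \<Rightarrow> nat set \<Rightarrow> nat \<Rightarrow> nat set" where
  "digit_set M D k = {(\<Sum>j<k. a j * M ^ j) | a. \<forall>j<k. a j \<in> D}"

text \<open>For nonempty digit sets and \<open>M \<ge> 2\<close> the set below contains \<open>0\<close> (the norms are at most \<open>1\<close>)
  and is bounded above by \<open>1/2\<close> (the norms are at least the modulus \<open>M powr (- k / 2)\<close> of a single
  matrix entry), so the real supremum is a genuine one.\<close>

definition fup_exponent :: "nat \<Rightarrow> nat set \<Rightarrow> nat set \<Rightarrow> real" where
  "fup_exponent M A B = Sup {\<beta>. \<exists>C>0. \<forall>k\<ge>1.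
     l2_op_norm (indicator_mat (M ^ k) (digit_set M A k) * dft_mat (M ^ k)
                 * indicator_mat (M ^ k) (digit_set M B k))
       \<le> C * real M powr (- (real k * \<beta>))}"

end

theory Submission
  imports Defs
begin

text \<open>
  Let \<open>A\<^sub>k\<close> and \<open>B\<^sub>k\<close> be the sets of \<open>k\<close>-digit numbers and let \<open>T\<^sub>k\<close> be the restricted Fourier
  matrix. Its Gram matrix \<open>T\<^sub>k\<^sup>* T\<^sub>k\<close> is \<open>(card A / M) ^ k\<close> times the matrix with entries
  \<open>P\<^sub>k (b - b')\<close> for \<open>b, b' \<in> B\<^sub>k\<close>, where \<open>P\<^sub>k t\<close> (\<open>digit_hat\<close>) is the product of the values of
  the transform \<open>f\<close> of the uniform measure on \<open>A\<close> at \<open>t / M, t / M\<^sup>2, \<dots>, t / M ^ k\<close>. The diagonal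
  entries are \<open>1\<close>, so \<open>\<parallel>T\<^sub>k\<parallel>\<^sup>2\<close> is at least \<open>(card A / M) ^ k\<close>, and the exponent never exceeds
  \<open>(1 - \<delta>) / 2\<close>. Equality of the exponents means that the normalised Gram matrix has subexponential
  norm.

  If the condition on \<open>f\<close> holds, then \<open>P\<^sub>k (b - b')\<close> vanishes unless \<open>b\<close> and \<open>b'\<close> agree in all
  digits except perhaps the top one: a difference in the digit at position \<open>i\<close>, with equal digits
  below, makes one of two consecutive factors zero
  (\<open>digit_hat_nonzero_imp_mod_eq\<close>). The Gram matrix then consists of blocks of bounded size, and
  Schur's test gives \<open>\<parallel>T\<^sub>k\<parallel>\<^sup>2 \<le> card B * (card A / M) ^ k\<close>.

  If the condition fails, there is a difference \<open>d \<noteq> 0\<close> of two-digit numbers such that no factor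
  \<open>f (d / M ^ r)\<close> is zero (\<open>surviving_difference\<close>). This is the arithmetic core. A failure of the
  condition controls only the factors for the first two digits; the others might vanish as well. But
  among frequencies of modulus at most \<open>1 / M\<close> the function \<open>f\<close> has at most one pair \<open>\<plusminus> t\<close> of
  zeros, because cosine sums over points of an interval of length less than \<open>M\<close>, taken about its midpoint,
  depend strictly monotonically on the frequency (\<open>small_nu_hat_zeros_unique\<close>). Two candidates for \<open>d\<close>
  can fail only at two frequencies in this range with different moduli, so one of them succeeds.

  For such \<open>d\<close> the products \<open>P\<^sub>m d\<close> stay away from zero uniformly in \<open>m\<close>. After a long run of
  equal digits the influence of an earlier difference on the following factors is negligible, and the
  difference \<open>d\<close> can be introduced again or not, at will. For a fixed \<open>b\<close>, each such free choice
  multiplies \<open>\<Sum>b'. \<bar>P\<^sub>k (b' - b)\<bar>\<^sup>2\<close> by a factor that is larger than \<open>1\<close> and does not depend on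
  \<open>k\<close> (\<open>column_growth\<close>). This sum is a lower bound for the squared norm of the normalised Gram
  matrix, which therefore grows exponentially, and the exponent is strictly below \<open>(1 - \<delta>) / 2\<close>.
\<close>

section \<open>Transforms of uniform measures on finite sets of naturals\<close>

definition phase :: "real \<Rightarrow> complex" where
  "phase x = cis (- 2 * pi * x)"

lemma phase_add: "phase (x + y) = phase x * phase y"
  by (simp add: phase_def cis_mult algebra_simps)

lemma phase_minus: "phase (- x) = cnj (phase x)"
  by (simp add: phase_def cis_cnj)

lemma phase_of_int [simp]: "phase (of_int z) = 1"
  using cis_multiple_2pi[of "of_int (- z)"] by (simp add: phase_def algebra_simps)

lemma norm_phase [simp]: "norm (phase x) = 1"
  by (simp add: phase_def)

lemma norm_phase_diff_le: "norm (phase x - phase y) \<le> 2 * pi * \<bar>x - y\<bar>"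
proof -
  have "norm (cis s - cis t) \<le> \<bar>s - t\<bar>" for s t :: real
  proof -
    have "norm (cis s - cis t) = norm (cis t * (cis (s - t) - 1))"
      by (simp add: algebra_simps cis_mult)
    also have "\<dots> = norm (cis (s - t) - 1)"
      by (simp add: norm_mult)
    also have "\<dots> \<le> \<bar>s - t\<bar>"
    proof (rule power2_le_imp_le)
      have "(norm (cis (s - t) - 1))\<^sup>2 = (cos (s - t) - 1)\<^sup>2 + (sin (s - t))\<^sup>2"
        by (simp add: cmod_power2)
      also have "\<dots> = 2 - 2 * cos (s - t)"
        using sin_cos_squared_add[of "s - t"] by (simp add: power2_diff)
      also have "\<dots> = (2 * sin ((s - t) / 2))\<^sup>2"
        using cos_double_sin[of "(s - t) / 2"] by (simp add: power_mult_distrib diff_divide_distrib)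
      also have "\<dots> \<le> (\<bar>s - t\<bar>)\<^sup>2"
        unfolding abs_le_square_iff[symmetric]
        using abs_sin_x_le_abs_x[of "(s - t) / 2"] by (simp add: abs_mult)
      finally show "(norm (cis (s - t) - 1))\<^sup>2 \<le> (\<bar>s - t\<bar>)\<^sup>2" .
    qed simp
    finally show ?thesis .
  qed
  from this[of "- 2 * pi * x" "- 2 * pi * y"]
  have "norm (phase x - phase y) \<le> \<bar>(- 2 * pi) * (x - y)\<bar>"
    by (simp add: phase_def algebra_simps)
  thus ?thesis by (simp add: abs_mult)
qed

lemma nu_hat_image_real:
  "nu_hat (real ` E) \<xi> = (\<Sum>a\<in>E. phase (\<xi> * real a)) / of_nat (card E)"
proof -
  have "exp (- 2 * of_real pi * \<i> * of_real \<xi> * of_real (real a)) = phase (\<xi> * real a)" for a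
    by (simp add: phase_def cis_conv_exp algebra_simps)
  thus ?thesis
    by (simp add: nu_hat_def sum.reindex card_image)
qed

lemma nu_hat_uminus: "nu_hat (real ` E) (- \<xi>) = cnj (nu_hat (real ` E) \<xi>)"
  by (simp add: nu_hat_image_real phase_minus)

lemma nu_hat_add_int: "nu_hat (real ` E) (\<xi> + of_int z) = nu_hat (real ` E) \<xi>"
proof -
  have "phase ((\<xi> + of_int z) * real a) = phase (\<xi> * real a)" for a
    using phase_of_int[of "z * int a"] by (simp add: distrib_right phase_add)
  thus ?thesis by (simp add: nu_hat_image_real)
qed

lemma norm_nu_hat_le_1: "norm (nu_hat (real ` E) \<xi>) \<le> 1"
proof -
  have "norm (\<Sum>a\<in>E. phase (\<xi> * real a)) \<le> real (card E)"
    using norm_sum[of "\<lambda>a. phase (\<xi> * real a)" E] by simp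
  thus ?thesis
    by (cases "card E = 0") (simp_all add: nu_hat_image_real norm_divide divide_le_eq_1)
qed

text \<open>A number in \<open>{..<N}\<close> divided by \<open>N\<close> is at most \<open>1\<close>, so the rescaled transform is Lipschitz
  with a constant that does not depend on \<open>N\<close>. For digit sets this gives an estimate that is
  uniform in the number of digits.\<close>

lemma norm_nu_hat_diff_le:
  assumes "E \<subseteq> {..<N}"
  shows "norm (nu_hat (real ` E) (x / real N) - nu_hat (real ` E) (y / real N)) \<le> 2 * pi * \<bar>x - y\<bar>"
proof (cases "E = {}")
  case True
  thus ?thesis by (simp add: nu_hat_def)
next
  case False
  have fin: "finite E" using assms finite_subset by blast
  have N: "N > 0" using assms False by auto
  have "norm (phase (x / N * a) - phase (y / N * a)) \<le> 2 * pi * \<bar>x - y\<bar>" if "a \<in> E" for a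
  proof -
    have "norm (phase (x / N * a) - phase (y / N * a)) \<le> 2 * pi * \<bar>x / N * a - y / N * a\<bar>"
      by (rule norm_phase_diff_le)
    also have "x / N * a - y / N * a = (x - y) * (a / N)"
      by (simp add: algebra_simps diff_divide_distrib)
    also have "2 * pi * \<bar>(x - y) * (a / N)\<bar> = 2 * pi * (\<bar>x - y\<bar> * (a / N))"
      by (simp add: abs_mult)
    also have "\<dots> \<le> 2 * pi * (\<bar>x - y\<bar> * 1)"
      using that assms N by (intro mult_left_mono) (auto simp: divide_le_eq_1)
    finally show ?thesis by simp
  qed
  hence "norm (\<Sum>a\<in>E. phase (x / N * a) - phase (y / N * a)) \<le> of_nat (card E) * (2 * pi * \<bar>x - y\<bar>)"
    by (intro sum_norm_bound)
  moreover have "card E > 0" using fin False by (simp add: card_gt_0_iff)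
  ultimately show ?thesis
    by (simp add: nu_hat_image_real norm_divide sum_subtractf diff_divide_distrib[symmetric] field_simps)
qed

lemma nu_hat_0: "finite E \<Longrightarrow> E \<noteq> {} \<Longrightarrow> nu_hat (real ` E) 0 = 1"
  using phase_of_int[of 0] by (simp add: nu_hat_image_real)

section \<open>Digit sets and their Fourier products\<close>

lemma digit_set_0 [simp]: "digit_set M D 0 = {0}"
  by (auto simp: digit_set_def)

lemma digit_set_1 [simp]: "digit_set M D (Suc 0) = D"
  by (auto simp: digit_set_def)

lemma digit_set_add:
  "digit_set M D (k + l) = (\<lambda>(x, y). x + M ^ k * y) ` (digit_set M D k \<times> digit_set M D l)"
proof -
  have split: "(\<Sum>j<k + l. a j * M ^ j) = (\<Sum>j<k. a j * M ^ j) + M ^ k * (\<Sum>j<l. a (k + j) * M ^ j)"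
    for a :: "nat \<Rightarrow> nat"
    by (induction l) (simp_all add: algebra_simps power_add)
  show ?thesis
  proof (intro equalityI subsetI)
    fix x assume "x \<in> digit_set M D (k + l)"
    then obtain a where a: "\<forall>j<k + l. a j \<in> D" and x: "x = (\<Sum>j<k + l. a j * M ^ j)"
      by (auto simp: digit_set_def)
    have "(\<Sum>j<k. a j * M ^ j) \<in> digit_set M D k"
      using a by (auto simp: digit_set_def)
    moreover have "(\<Sum>j<l. a (k + j) * M ^ j) \<in> digit_set M D l"
      using a by (auto simp: digit_set_def intro!: exI[of _ "\<lambda>j. a (k + j)"])
    ultimately show "x \<in> (\<lambda>(x, y). x + M ^ k * y) ` (digit_set M D k \<times> digit_set M D l)"
      unfolding x split by force
  next
    fix x assume "x \<in> (\<lambda>(x, y). x + M ^ k * y) ` (digit_set M D k \<times> digit_set M D l)"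
    then obtain a b where a: "\<forall>j<k. a j \<in> D" and b: "\<forall>j<l. b j \<in> D"
      and x: "x = (\<Sum>j<k. a j * M ^ j) + M ^ k * (\<Sum>j<l. b j * M ^ j)"
      by (auto simp: digit_set_def)
    define c where "c = (\<lambda>j. if j < k then a j else b (j - k))"
    have "x = (\<Sum>j<k + l. c j * M ^ j)"
      unfolding split x by (simp add: c_def)
    moreover have "\<forall>j<k + l. c j \<in> D"
      using a b by (auto simp: c_def)
    ultimately show "x \<in> digit_set M D (k + l)"
      by (auto simp: digit_set_def)
  qed
qed

lemma digit_set_addI:
  "x \<in> digit_set M D k \<Longrightarrow> y \<in> digit_set M D l \<Longrightarrow> x + M ^ k * y \<in> digit_set M D (k + l)"
  unfolding digit_set_add by force

lemma digit_set_Suc_cases: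
  assumes "x \<in> digit_set M D (Suc k)"
  obtains b y where "b \<in> D" "y \<in> digit_set M D k" "x = b + M * y"
  using assms digit_set_add[of M D "Suc 0" k] by auto

locale digit_alphabet =
  fixes M :: nat and D :: "nat set"
  assumes digits_less: "D \<subseteq> {..<M}" and nonempty: "D \<noteq> {}"
begin

lemma base_pos: "M > 0"
  using digits_less nonempty by auto

lemma digit_set_less: "x \<in> digit_set M D k \<Longrightarrow> x < M ^ k"
proof (induction k arbitrary: x)
  case (Suc k)
  then obtain b y where b: "b \<in> D" and y: "y \<in> digit_set M D k" and x: "x = b + M * y"
    by (rule_tac digit_set_Suc_cases)
  have "M * Suc y \<le> M * M ^ k"
    using Suc.IH[OF y] by (intro mult_left_mono) auto
  moreover have "b < M" using b digits_less by auto
  ultimately show ?case by (simp add: x)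
qed auto

lemma digit_set_subset: "digit_set M D k \<subseteq> {..<M ^ k}"
  using digit_set_less by auto

lemma finite_digit_set: "finite (digit_set M D k)"
  using digit_set_subset finite_subset by blast

lemma digit_set_nonempty: "digit_set M D k \<noteq> {}"
proof -
  obtain b where "b \<in> D" using nonempty by auto
  hence "(\<Sum>j<k. (\<lambda>_. b) j * M ^ j) \<in> digit_set M D k"
    by (auto simp: digit_set_def intro!: exI[of _ "\<lambda>_. b"])
  thus ?thesis by blast
qed

lemma inj_on_digit_set_add:
  "inj_on (\<lambda>(x, y). x + M ^ k * y) (digit_set M D k \<times> Y)"
proof (rule inj_onI, clarify)
  fix x y x' y'
  assume "x \<in> digit_set M D k" "x' \<in> digit_set M D k" and eq: "x + M ^ k * y = x' + M ^ k * y'"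
  hence less: "x < M ^ k" "x' < M ^ k" using digit_set_less by auto
  have "(x + M ^ k * y) mod M ^ k = (x' + M ^ k * y') mod M ^ k"
    "(x + M ^ k * y) div M ^ k = (x' + M ^ k * y') div M ^ k"
    by (simp_all only: eq)
  thus "x = x' \<and> y = y'" using less base_pos by simp
qed

lemma card_digit_set: "card (digit_set M D k) = card D ^ k"
proof (induction k)
  case (Suc k)
  show ?case
    using digit_set_add[of M D k "Suc 0"] inj_on_digit_set_add[of k D] Suc.IH
    by (simp add: card_image card_cartesian_product)
qed auto

text \<open>
  The transform of the uniform measure on the \<open>k\<close>-digit numbers, rescaled so that a difference
  of two \<open>k\<close>-digit numbers is an argument that can be inserted as it is; in this scaling the
  function has period \<open>M ^ k\<close>.
\<close>

definition digit_hat :: "nat \<Rightarrow> real \<Rightarrow> complex" where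
  "digit_hat k t = nu_hat (real ` digit_set M D k) (t / real (M ^ k))"

text \<open>Digits are chosen independently, so the uniform measure on \<open>(k + l)\<close>-digit numbers is a
  convolution and its transform factorises. Iterating the rule with \<open>l = 1\<close> writes
  \<open>digit_hat k t\<close> as the product of the values of \<open>nu_hat\<close> at \<open>t / M\<close>, \<open>t / M\<^sup>2\<close>, \<open>\<dots>\<close>,
  \<open>t / M ^ k\<close>.\<close>

lemma digit_hat_add: "digit_hat (k + l) t = digit_hat k (t / real (M ^ l)) * digit_hat l t"
proof -
  have "(\<Sum>a\<in>digit_set M D (k + l). phase (t / real (M ^ (k + l)) * real a)) =
    (\<Sum>(x, y)\<in>digit_set M D k \<times> digit_set M D l.
        phase (t / real (M ^ (k + l)) * real (x + M ^ k * y)))"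
    unfolding digit_set_add sum.reindex[OF inj_on_digit_set_add]
    by (simp add: o_def case_prod_unfold)
  also have "\<dots> = (\<Sum>(x, y)\<in>digit_set M D k \<times> digit_set M D l.
        phase (t / real (M ^ l) / real (M ^ k) * real x) * phase (t / real (M ^ l) * real y))"
  proof (rule sum.cong[OF refl], clarify)
    fix x y
    have "t / real (M ^ (k + l)) * real (x + M ^ k * y) =
      t / real (M ^ l) / real (M ^ k) * real x + t / real (M ^ l) * real y"
      using base_pos by (simp add: field_simps power_add)
    thus "phase (t / real (M ^ (k + l)) * real (x + M ^ k * y)) =
      phase (t / real (M ^ l) / real (M ^ k) * real x) * phase (t / real (M ^ l) * real y)"
      by (simp only: phase_add)
  qed
  finally show ?thesis
    by (simp add: digit_hat_def nu_hat_image_real card_digit_set power_add sum_product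
        sum.cartesian_product)
qed

lemma digit_hat_0 [simp]: "digit_hat 0 t = 1"
  by (simp add: digit_hat_def nu_hat_def)

lemma digit_hat_1: "digit_hat (Suc 0) t = nu_hat (real ` D) (t / real M)"
  by (simp add: digit_hat_def)

lemma digit_hat_at_0: "digit_hat k 0 = 1"
  by (simp add: digit_hat_def nu_hat_0 finite_digit_set digit_set_nonempty)

lemma norm_digit_hat_le_1: "norm (digit_hat k t) \<le> 1"
  by (simp add: digit_hat_def norm_nu_hat_le_1)

lemma digit_hat_periodic: "digit_hat k (t + of_int z * real (M ^ k)) = digit_hat k t"
  using base_pos nu_hat_add_int[of "digit_set M D k" "t / real (M ^ k)" z]
  by (simp add: digit_hat_def add_divide_distrib)

lemma norm_digit_hat_diff_le: "norm (digit_hat k s - digit_hat k t) \<le> 2 * pi * \<bar>s - t\<bar>"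
  unfolding digit_hat_def by (rule norm_nu_hat_diff_le[OF digit_set_subset])

lemma digit_hat_nonzero:
  assumes "\<And>r. r \<ge> 1 \<Longrightarrow> nu_hat (real ` D) (d / real (M ^ r)) \<noteq> 0"
  shows "digit_hat k d \<noteq> 0"
proof (induction k)
  case (Suc k)
  have "digit_hat (Suc k) d = nu_hat (real ` D) (d / real (M ^ Suc k)) * digit_hat k d"
    using digit_hat_add[of "Suc 0" k d] by (simp add: digit_hat_1 mult.commute)
  thus ?case using Suc.IH assms[of "Suc k"] by simp
qed simp

text \<open>The factors at \<open>d / M ^ r\<close> tend to \<open>1\<close> so fast that their product converges. Finitely many
  of them are split off, and the product of all the others is itself a value of \<open>digit_hat\<close> at a
  point so close to \<open>0\<close> that the Lipschitz estimate keeps it above \<open>1/2\<close> in modulus.\<close>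

lemma digit_hat_bounded_below:
  assumes "M \<ge> 2" and nz: "\<And>r. r \<ge> 1 \<Longrightarrow> nu_hat (real ` D) (d / real (M ^ r)) \<noteq> 0"
  obtains c q where "c > 0" "\<And>k. k \<ge> q \<Longrightarrow> c \<le> norm (digit_hat k d)"
proof -
  obtain q where q: "4 * pi * \<bar>d\<bar> < real M ^ q"
    using real_arch_pow[of "real M"] \<open>M \<ge> 2\<close> by auto
  show ?thesis
  proof (rule that[of "norm (digit_hat q d) / 2" q])
    show "norm (digit_hat q d) / 2 > 0"
      using digit_hat_nonzero[OF nz] by simp
    fix k assume "k \<ge> q"
    have "norm (digit_hat (k - q) (d / real (M ^ q)) - 1) \<le> 2 * pi * \<bar>d / real (M ^ q) - 0\<bar>"
      using norm_digit_hat_diff_le[of "k - q" "d / real (M ^ q)" 0] by (simp only: digit_hat_at_0)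
    also have "\<dots> \<le> 1 / 2"
      using q base_pos by (simp add: field_simps)
    finally have "1 / 2 \<le> norm (digit_hat (k - q) (d / real (M ^ q)))"
      using norm_triangle_ineq2[of 1 "digit_hat (k - q) (d / real (M ^ q))"]
      by (simp add: norm_minus_commute)
    hence "1 / 2 * norm (digit_hat q d) \<le> norm (digit_hat (k - q) (d / real (M ^ q))) * norm (digit_hat q d)"
      by (rule mult_right_mono) simp
    thus "norm (digit_hat q d) / 2 \<le> norm (digit_hat k d)"
      using digit_hat_add[of "k - q" q d] \<open>k \<ge> q\<close> by (simp add: norm_mult)
  qed
qed

end

section \<open>Zeros of the transform near the origin\<close>

text \<open>Translating the set multiplies its transform by a unimodular number, so a zero remains a zero
  when phases are measured from any centre \<open>c\<close>; the real part is kept.\<close>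

lemma nu_hat_zero_imp_cos_sum_zero:
  assumes "finite E" "E \<noteq> {}" and zero: "nu_hat (real ` E) s = 0"
  shows "(\<Sum>a\<in>E. cos (2 * pi * s * (real a - c))) = 0"
proof -
  have "card E > 0" using assms by (simp add: card_gt_0_iff)
  hence "(\<Sum>a\<in>E. phase (s * real a)) = 0"
    using zero by (simp add: nu_hat_image_real)
  hence "0 = phase (- (s * c)) * (\<Sum>a\<in>E. phase (s * real a))"
    by simp
  also have "\<dots> = (\<Sum>a\<in>E. phase (s * (real a - c)))"
    by (simp add: sum_distrib_left algebra_simps flip: phase_add)
  finally have "0 = Re (\<Sum>a\<in>E. phase (s * (real a - c)))" by simp
  also have "\<dots> = (\<Sum>a\<in>E. cos (2 * pi * s * (real a - c)))"
    using cos_minus[of "2 * pi * (s * (_ - c))"] by (simp add: phase_def mult.assoc)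
  finally show ?thesis by simp
qed

context
  fixes E :: "nat set" and M :: nat
  assumes E: "E \<subseteq> {..<M}"
begin

private lemma centred_le: "a \<in> E \<Longrightarrow> \<bar>real a - (real M - 1) / 2\<bar> < real M / 2"
  using E by (auto simp: abs_less_iff field_simps dest!: subsetD)

private lemma finite_E: "finite E"
  using E finite_subset by blast

text \<open>With the phases measured from the midpoint of \<open>{0..M - 1}\<close>, all of them lie in the open right
  half-plane.\<close>

lemma nu_hat_nonzero_if_small:
  assumes "E \<noteq> {}" and s: "\<bar>s\<bar> \<le> 1 / (2 * real M)"
  shows "nu_hat (real ` E) s \<noteq> 0"
proof
  assume "nu_hat (real ` E) s = 0"
  hence "(\<Sum>a\<in>E. cos (2 * pi * s * (real a - (real M - 1) / 2))) = 0"
    using assms finite_E by (intro nu_hat_zero_imp_cos_sum_zero)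
  moreover have "cos (2 * pi * s * (real a - (real M - 1) / 2)) > 0" if "a \<in> E" for a
  proof -
    have M: "M > 0" using that E by auto
    have "\<bar>s\<bar> * \<bar>real a - (real M - 1) / 2\<bar> \<le> 1 / (2 * real M) * \<bar>real a - (real M - 1) / 2\<bar>"
      using s by (intro mult_right_mono) auto
    also have "\<dots> < 1 / (2 * real M) * (real M / 2)"
      using centred_le[OF that] M by (intro mult_strict_left_mono) auto
    also have "\<dots> = 1 / 4" using M by simp
    finally have "2 * pi * (\<bar>s\<bar> * \<bar>real a - (real M - 1) / 2\<bar>) < 2 * pi * (1 / 4)"
      by (intro mult_strict_left_mono) auto
    also have "2 * pi * (\<bar>s\<bar> * \<bar>real a - (real M - 1) / 2\<bar>) = \<bar>2 * pi * s * (real a - (real M - 1) / 2)\<bar>"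
      unfolding abs_mult by simp
    also have "2 * pi * (1 / 4) = pi / 2" by simp
    finally have "\<bar>2 * pi * s * (real a - (real M - 1) / 2)\<bar> < pi / 2" .
    thus ?thesis by (intro cos_gt_zero_pi) (simp_all only: abs_less_iff minus_less_iff)
  qed
  hence "(\<Sum>a\<in>E. cos (2 * pi * s * (real a - (real M - 1) / 2))) > 0"
    using assms finite_E by (intro sum_pos) auto
  ultimately show False by simp
qed

text \<open>With phases measured from the midpoint of \<open>{0..M - 1}\<close>, the angles at a frequency of modulus at
  most \<open>1 / M\<close> stay in \<open>[- pi, pi]\<close>, where the cosine decreases with the modulus. Of two such
  frequencies the smaller one therefore has the larger cosine at every point other than the midpoint,
  and the two cosine sums cannot both vanish.\<close>

lemma small_nu_hat_zeros_unique:
  assumes "1 < card E" "\<bar>s\<bar> \<le> 1 / real M" "\<bar>t\<bar> \<le> 1 / real M"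
    "nu_hat (real ` E) s = 0" "nu_hat (real ` E) t = 0"
  shows "\<bar>s\<bar> = \<bar>t\<bar>"
proof -
  have "\<not> \<bar>s\<bar> < \<bar>t\<bar>" if t: "\<bar>t\<bar> \<le> 1 / real M"
    and zeros: "nu_hat (real ` E) s = 0" "nu_hat (real ` E) t = 0" for s t
  proof
    assume less: "\<bar>s\<bar> < \<bar>t\<bar>"
    define c where "c = (real M - 1) / 2"
    have ne: "E \<noteq> {}" using assms(1) by auto
    have sums: "(\<Sum>a\<in>E. cos (2 * pi * t * (real a - c))) = (\<Sum>a\<in>E. cos (2 * pi * s * (real a - c)))"
      using nu_hat_zero_imp_cos_sum_zero[OF finite_E ne] zeros by simp
    have abs_form: "cos (2 * pi * u * y) = cos (2 * pi * (\<bar>u\<bar> * \<bar>y\<bar>))" for u y :: real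
    proof -
      have "cos (2 * pi * u * y) = cos \<bar>2 * pi * u * y\<bar>" by simp
      thus ?thesis by (simp add: abs_mult mult_ac del: cos_abs_real)
    qed
    have le_pi: "2 * pi * (\<bar>t\<bar> * \<bar>real a - c\<bar>) \<le> pi" if "a \<in> E" for a
    proof -
      have M: "M > 0" using that E by auto
      have "\<bar>t\<bar> * \<bar>real a - c\<bar> \<le> 1 / real M * (real M / 2)"
        using centred_le[OF that] t by (intro mult_mono) (auto simp: c_def)
      also have "\<dots> = 1 / 2" using M by simp
      finally have "2 * pi * (\<bar>t\<bar> * \<bar>real a - c\<bar>) \<le> 2 * pi * (1 / 2)"
        by (intro mult_left_mono) auto
      thus ?thesis by simp
    qed
    have strict: "cos (2 * pi * t * (real a - c)) < cos (2 * pi * s * (real a - c))"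
      if a: "a \<in> E" "real a \<noteq> c" for a
      unfolding abs_form using le_pi[OF a(1)] less a(2)
      by (intro cos_monotone_0_pi mult_strict_left_mono mult_strict_right_mono) auto
    have "\<exists>a\<in>E. real a \<noteq> c"
    proof (rule ccontr)
      assume "\<not> (\<exists>a\<in>E. real a \<noteq> c)"
      hence "\<forall>a\<in>E. \<forall>b\<in>E. a = b" by (metis of_nat_eq_iff)
      thus False using assms(1) finite_E card_le_Suc0_iff_eq[of E] by simp
    qed
    hence "(\<Sum>a\<in>E. cos (2 * pi * t * (real a - c))) < (\<Sum>a\<in>E. cos (2 * pi * s * (real a - c)))"
      using finite_E strict by (intro sum_strict_mono_ex1) (force intro: less_imp_le)+
    with sums show False by simp
  qed
  from this[of t s] this[of s t] show ?thesis using assms by force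
qed

end

section \<open>Norms of restricted Fourier matrices\<close>

lemma l2_norm_vec_nonneg: "0 \<le> l2_norm_vec v"
  by (simp add: l2_norm_vec_def L2_set_nonneg)

lemma l2_norm_vec_power2: "(l2_norm_vec v)\<^sup>2 = (\<Sum>i<dim_vec v. (cmod (vec_index v i))\<^sup>2)"
  by (simp add: l2_norm_vec_def L2_set_def sum_nonneg)

lemma norm_inner_le_l2_norm_vec:
  assumes "dim_vec v = N" "dim_vec w = N"
  shows "norm (\<Sum>i<N. vec_index v i * cnj (vec_index w i)) \<le> l2_norm_vec v * l2_norm_vec w"
proof -
  have "norm (\<Sum>i<N. vec_index v i * cnj (vec_index w i))
      \<le> (\<Sum>i<N. \<bar>cmod (vec_index v i)\<bar> * \<bar>cmod (vec_index w i)\<bar>)"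
    by (rule order_trans[OF norm_sum]) (simp add: norm_mult)
  also have "\<dots> \<le> l2_norm_vec v * l2_norm_vec w"
    unfolding l2_norm_vec_def assms by (rule L2_set_mult_ineq)
  finally show ?thesis .
qed

lemma l2_op_norm_le:
  assumes "0 \<le> K" "\<And>v. v \<in> carrier_vec (dim_col T) \<Longrightarrow> l2_norm_vec (T *\<^sub>v v) \<le> K * l2_norm_vec v"
  shows "l2_op_norm T \<le> K"
  unfolding l2_op_norm_def
proof (rule cSUP_least)
  show "carrier_vec (dim_col T) \<noteq> ({} :: complex vec set)"
    using zero_carrier_vec by blast
next
  fix v :: "complex vec" assume "v \<in> carrier_vec (dim_col T)"
  thus "l2_norm_vec (T *\<^sub>v v) / l2_norm_vec v \<le> K"
    using assms l2_norm_vec_nonneg[of v]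
    by (cases "l2_norm_vec v = 0") (auto simp: divide_le_eq)
qed

text \<open>The operator norm is a supremum of reals, which says something only once the quotients are known to
  be bounded; \<open>K\<close> is any such bound.\<close>

context
  fixes T :: "complex mat" and K :: real
  assumes bound: "\<And>v. v \<in> carrier_vec (dim_col T) \<Longrightarrow> l2_norm_vec (T *\<^sub>v v) \<le> K * l2_norm_vec v"
begin

lemma l2_op_norm_bdd_above:
  "bdd_above ((\<lambda>v. l2_norm_vec (T *\<^sub>v v) / l2_norm_vec v) ` carrier_vec (dim_col T))"
proof (rule bdd_aboveI2)
  fix w :: "complex vec" assume "w \<in> carrier_vec (dim_col T)"
  thus "l2_norm_vec (T *\<^sub>v w) / l2_norm_vec w \<le> max K 0"
    using bound[of w] l2_norm_vec_nonneg[of w]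
    by (cases "l2_norm_vec w = 0") (auto simp: divide_le_eq max_def intro: order_trans mult_nonpos_nonneg)
qed

lemma l2_op_norm_nonneg: "0 \<le> l2_op_norm T"
  unfolding l2_op_norm_def
  by (rule cSUP_upper2[OF l2_op_norm_bdd_above zero_carrier_vec]) (simp add: l2_norm_vec_nonneg)

lemma l2_norm_mult_vec_le:
  assumes v: "v \<in> carrier_vec (dim_col T)"
  shows "l2_norm_vec (T *\<^sub>v v) \<le> l2_op_norm T * l2_norm_vec v"
proof (cases "l2_norm_vec v = 0")
  case True
  thus ?thesis using bound[OF v] by simp
next
  case False
  hence "l2_norm_vec v > 0" using l2_norm_vec_nonneg[of v] by simp
  moreover have "l2_norm_vec (T *\<^sub>v v) / l2_norm_vec v \<le> l2_op_norm T"
    unfolding l2_op_norm_def using v by (intro cSUP_upper l2_op_norm_bdd_above)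
  ultimately show ?thesis by (simp add: divide_le_eq)
qed

end

lemma indicator_mat_mult_vec:
  assumes "v \<in> carrier_vec N"
  shows "indicator_mat N E *\<^sub>v v = vec N (\<lambda>i. indicator E i * vec_index v i)"
proof (rule eq_vecI)
  fix i assume "i < dim_vec (vec N (\<lambda>i. indicator E i * vec_index v i))"
  hence i: "i < N" by simp
  have "vec_index (indicator_mat N E *\<^sub>v v) i
      = (\<Sum>j\<in>{0..<N}. (if i = j then indicator E j else 0) * vec_index v j)"
    using i assms by (simp add: indicator_mat_def mat_diag_def scalar_prod_def)
  also have "\<dots> = (\<Sum>j\<in>{0..<N}. if i = j then indicator E j * vec_index v j else 0)"
    by (intro sum.cong) auto
  also have "\<dots> = indicator E i * vec_index v i"
    using i by simp
  finally show "vec_index (indicator_mat N E *\<^sub>v v) i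
      = vec_index (vec N (\<lambda>i. indicator E i * vec_index v i)) i"
    using i by simp
qed (simp add: indicator_mat_def mat_diag_def)

definition restricted_dft :: "nat \<Rightarrow> nat set \<Rightarrow> nat set \<Rightarrow> complex mat" where
  "restricted_dft N E F = indicator_mat N E * dft_mat N * indicator_mat N F"

lemma restricted_dft_carrier: "restricted_dft N E F \<in> carrier_mat N N"
  by (auto simp: restricted_dft_def indicator_mat_def mat_diag_def dft_mat_def)

lemma dft_mat_index:
  "i < N \<Longrightarrow> j < N \<Longrightarrow> dft_mat N $$ (i, j) = phase (real i * real j / real N) / of_real (sqrt (real N))"
  by (simp add: dft_mat_def phase_def cis_conv_exp algebra_simps)

lemma restricted_dft_mult_vec:
  assumes v: "v \<in> carrier_vec N" and F: "F \<subseteq> {..<N}" and i: "i < N"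
  shows "vec_index (restricted_dft N E F *\<^sub>v v) i =
    indicator E i * (\<Sum>j\<in>F. phase (real i * real j / real N) * vec_index v j) / of_real (sqrt (real N))"
proof -
  have car: "indicator_mat N E \<in> carrier_mat N N" "indicator_mat N F \<in> carrier_mat N N"
    "dft_mat N \<in> carrier_mat N N"
    by (auto simp: indicator_mat_def mat_diag_def dft_mat_def)
  define w where "w = vec N (\<lambda>i. indicator F i * vec_index v i)"
  have w: "w \<in> carrier_vec N" by (simp add: w_def)
  have "restricted_dft N E F *\<^sub>v v = indicator_mat N E *\<^sub>v (dft_mat N *\<^sub>v (indicator_mat N F *\<^sub>v v))"
    using car v by (simp add: restricted_dft_def assoc_mult_mat_vec[of _ N N _ N])
  also have "indicator_mat N F *\<^sub>v v = w"
    using v by (simp add: indicator_mat_mult_vec w_def)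
  finally have "vec_index (restricted_dft N E F *\<^sub>v v) i
      = indicator E i * vec_index (dft_mat N *\<^sub>v w) i"
    using i w car by (simp add: indicator_mat_mult_vec[where N = N])
  also have "vec_index (dft_mat N *\<^sub>v w) i = (\<Sum>j\<in>{0..<N}. dft_mat N $$ (i, j) * vec_index w j)"
    using i w car by (simp add: scalar_prod_def)
  also have "\<dots> = (\<Sum>j\<in>{0..<N}. if j \<in> F then
      phase (real i * real j / real N) * vec_index v j / of_real (sqrt (real N)) else 0)"
    by (intro sum.cong) (auto simp: dft_mat_index i w_def indicator_def)
  also have "\<dots> = (\<Sum>j\<in>{0..<N} \<inter> F. phase (real i * real j / real N) * vec_index v j / of_real (sqrt (real N)))"
    by (simp add: sum.inter_restrict)
  also have "{0..<N} \<inter> F = F" using F by auto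
  finally show ?thesis by (simp flip: sum_divide_distrib)
qed

text \<open>The columns of the restricted matrix have inner products that depend only on the difference of
  their indices, and as a function of this difference they are the transform of the uniform measure on
  the row set. Both estimates of the norm below are read off from this Gram matrix.\<close>

lemma restricted_dft_inner:
  assumes v: "v \<in> carrier_vec N" and w: "w \<in> carrier_vec N"
    and E: "E \<subseteq> {..<N}" and F: "F \<subseteq> {..<N}"
  shows "(\<Sum>i<N. vec_index (restricted_dft N E F *\<^sub>v v) i * cnj (vec_index (restricted_dft N E F *\<^sub>v w) i)) =
    of_real (real (card E) / real N) *
      (\<Sum>j\<in>F. \<Sum>l\<in>F. vec_index v j * cnj (vec_index w l) * nu_hat (real ` E) ((real j - real l) / real N))"
proof -
  have finE: "finite E" using E finite_subset by blast
  have sqrtN: "of_real (sqrt (real N)) * of_real (sqrt (real N)) = (of_nat N :: complex)"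
    by (simp flip: of_real_mult)
  have "(\<Sum>i<N. vec_index (restricted_dft N E F *\<^sub>v v) i * cnj (vec_index (restricted_dft N E F *\<^sub>v w) i))
    = (\<Sum>i<N. if i \<in> E then (\<Sum>j\<in>F. \<Sum>l\<in>F. vec_index v j * cnj (vec_index w l) *
          phase ((real j - real l) / real N * real i)) / of_nat N else 0)"
  proof (rule sum.cong[OF refl])
    fix i assume "i \<in> {..<N}"
    hence i: "i < N" by simp
    have ph: "phase (real i * real j / real N) * cnj (phase (real i * real l / real N)) =
        phase ((real j - real l) / real N * real i)" for j l
      by (simp flip: phase_minus phase_add) (simp add: algebra_simps diff_divide_distrib)
    have "(\<Sum>j\<in>F. phase (real i * real j / real N) * vec_index v j) *
        cnj (\<Sum>l\<in>F. phase (real i * real l / real N) * vec_index w l)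
      = (\<Sum>j\<in>F. \<Sum>l\<in>F. vec_index v j * cnj (vec_index w l) *
          (phase (real i * real j / real N) * cnj (phase (real i * real l / real N))))"
      by (simp add: sum_product mult_ac)
    thus "vec_index (restricted_dft N E F *\<^sub>v v) i * cnj (vec_index (restricted_dft N E F *\<^sub>v w) i) =
      (if i \<in> E then (\<Sum>j\<in>F. \<Sum>l\<in>F. vec_index v j * cnj (vec_index w l) *
          phase ((real j - real l) / real N * real i)) / of_nat N else 0)"
      unfolding restricted_dft_mult_vec[OF v F i] restricted_dft_mult_vec[OF w F i] ph
      by (simp add: indicator_def sqrtN)
  qed
  also have "\<dots> = (\<Sum>i\<in>{..<N} \<inter> E. (\<Sum>j\<in>F. \<Sum>l\<in>F. vec_index v j * cnj (vec_index w l) *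
          phase ((real j - real l) / real N * real i)) / of_nat N)"
    by (simp only: sum.inter_restrict[OF finite_lessThan])
  also have "{..<N} \<inter> E = E" using E by auto
  also have "(\<Sum>i\<in>E. (\<Sum>j\<in>F. \<Sum>l\<in>F. vec_index v j * cnj (vec_index w l) *
          phase ((real j - real l) / real N * real i)) / of_nat N)
    = (\<Sum>j\<in>F. \<Sum>l\<in>F. vec_index v j * cnj (vec_index w l) *
          (\<Sum>i\<in>E. phase ((real j - real l) / real N * real i)) / of_nat N)"
    unfolding sum_divide_distrib sum_distrib_left
    by (subst sum.swap, intro sum.cong[OF refl], subst sum.swap) simp
  also have "\<dots> = (\<Sum>j\<in>F. \<Sum>l\<in>F. of_real (real (card E) / real N) *
      (vec_index v j * cnj (vec_index w l) * nu_hat (real ` E) ((real j - real l) / real N)))"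
    using finE by (intro sum.cong) (auto simp: nu_hat_image_real)
  finally show ?thesis by (simp add: sum_distrib_left)
qed

text \<open>Schur's test for the Gram matrix: its entries have modulus at most \<open>1\<close>, and at most \<open>K\<close>
  of them are nonzero in each row.\<close>

lemma restricted_dft_schur:
  assumes v: "v \<in> carrier_vec N" and E: "E \<subseteq> {..<N}" and F: "F \<subseteq> {..<N}"
    and deg: "\<And>j. j \<in> F \<Longrightarrow> card {l \<in> F. nu_hat (real ` E) ((real j - real l) / real N) \<noteq> 0} \<le> K"
  shows "l2_norm_vec (restricted_dft N E F *\<^sub>v v)
    \<le> sqrt (real K * (real (card E) / real N)) * l2_norm_vec v"
proof -
  define Tv where "Tv = restricted_dft N E F *\<^sub>v v"
  define h where "h = (\<lambda>j l. nu_hat (real ` E) ((real j - real l) / real N))"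
  define \<chi> where "\<chi> = (\<lambda>j l. if h j l \<noteq> 0 then 1 else 0 :: real)"
  define x where "x = (\<lambda>j. (cmod (vec_index v j))\<^sup>2)"
  have finF: "finite F" using F finite_subset by blast
  have dimv: "dim_vec v = N" using v by simp
  have dimT: "dim_vec Tv = N" using restricted_dft_carrier[of N E F] by (auto simp: Tv_def)
  have "(h l j = 0) = (h j l = 0)" for j l
    using nu_hat_uminus[of E "(real j - real l) / real N"]
    by (simp only: h_def minus_divide_left minus_diff_eq complex_cnj_zero_iff)
  hence sym: "\<chi> l j = \<chi> j l" for j l by (simp only: \<chi>_def)
  have h_le: "norm (h j l) \<le> \<chi> j l" for j l
    by (simp add: h_def \<chi>_def norm_nu_hat_le_1)
  have "(l2_norm_vec Tv)\<^sup>2 = norm (\<Sum>i<N. vec_index Tv i * cnj (vec_index Tv i))"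
  proof -
    have "(\<Sum>i<N. vec_index Tv i * cnj (vec_index Tv i)) = of_real ((l2_norm_vec Tv)\<^sup>2)"
      by (simp only: l2_norm_vec_power2 dimT complex_norm_square of_real_sum)
    thus ?thesis by (simp only: norm_of_real) simp
  qed
  also have "\<dots> = real (card E) / real N * norm (\<Sum>j\<in>F. \<Sum>l\<in>F. vec_index v j * cnj (vec_index v l) * h j l)"
    unfolding Tv_def restricted_dft_inner[OF v v E F] h_def norm_mult norm_of_real by simp
  also have "\<dots> \<le> real (card E) / real N * (real K * (l2_norm_vec v)\<^sup>2)"
  proof (rule mult_left_mono)
    have "norm (\<Sum>j\<in>F. \<Sum>l\<in>F. vec_index v j * cnj (vec_index v l) * h j l)
      \<le> (\<Sum>j\<in>F. \<Sum>l\<in>F. \<chi> j l * x j / 2 + \<chi> l j * x l / 2)"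
    proof (intro sum_norm_le)
      fix j l
      have "2 * (cmod (vec_index v j) * cmod (vec_index v l)) \<le> x j + x l"
        unfolding x_def using sum_squares_bound[of "cmod (vec_index v j)" "cmod (vec_index v l)"] by simp
      hence "(cmod (vec_index v j) * cmod (vec_index v l)) * norm (h j l) \<le> ((x j + x l) / 2) * \<chi> j l"
        using h_le[of j l] by (intro mult_mono) (auto simp: x_def)
      thus "norm (vec_index v j * cnj (vec_index v l) * h j l) \<le> \<chi> j l * x j / 2 + \<chi> l j * x l / 2"
        by (simp add: norm_mult sym algebra_simps)
    qed
    also have "(\<Sum>j\<in>F. \<Sum>l\<in>F. \<chi> j l * x j / 2 + \<chi> l j * x l / 2) = (\<Sum>j\<in>F. \<Sum>l\<in>F. \<chi> j l * x j)"
    proof -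
      have "(\<Sum>j\<in>F. \<Sum>l\<in>F. \<chi> l j * x l / 2) = (\<Sum>j\<in>F. \<Sum>l\<in>F. \<chi> j l * x j / 2)"
        by (rule sum.swap)
      thus ?thesis by (simp add: sum.distrib flip: sum_divide_distrib)
    qed
    also have "\<dots> = (\<Sum>j\<in>F. real (card {l \<in> F. h j l \<noteq> 0}) * x j)"
    proof -
      have "(\<Sum>l\<in>F. \<chi> j l) = real (card {l \<in> F. h j l \<noteq> 0})" for j
        using finF by (simp add: \<chi>_def sum.If_cases Int_def)
      thus ?thesis by (simp flip: sum_distrib_right)
    qed
    also have "\<dots> \<le> (\<Sum>j\<in>F. real K * x j)"
      using deg by (intro sum_mono mult_right_mono) (auto simp: h_def x_def)
    also have "\<dots> \<le> real K * (l2_norm_vec v)\<^sup>2"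
      unfolding l2_norm_vec_power2 dimv sum_distrib_left[symmetric] x_def
      using F by (intro mult_left_mono sum_mono2) auto
    finally show "norm (\<Sum>j\<in>F. \<Sum>l\<in>F. vec_index v j * cnj (vec_index v l) * h j l) \<le> real K * (l2_norm_vec v)\<^sup>2" .
  qed simp
  finally have "(l2_norm_vec Tv)\<^sup>2 \<le> real K * (real (card E) / real N) * (l2_norm_vec v)\<^sup>2"
    by (simp add: mult_ac)
  hence "l2_norm_vec Tv \<le> sqrt (real K * (real (card E) / real N) * (l2_norm_vec v)\<^sup>2)"
    by (rule real_le_rsqrt)
  also have "\<dots> = sqrt (real K * (real (card E) / real N)) * l2_norm_vec v"
    unfolding real_sqrt_mult[of _ "(l2_norm_vec v)\<^sup>2"] by (simp add: l2_norm_vec_nonneg)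
  finally show ?thesis by (simp only: Tv_def)
qed

lemma restricted_dft_norm_le:
  assumes E: "E \<subseteq> {..<N}" and F: "F \<subseteq> {..<N}"
    and deg: "\<And>j. j \<in> F \<Longrightarrow> card {l \<in> F. nu_hat (real ` E) ((real j - real l) / real N) \<noteq> 0} \<le> K"
  shows "l2_op_norm (restricted_dft N E F) \<le> sqrt (real K * (real (card E) / real N))"
  using restricted_dft_schur[OF _ assms] restricted_dft_carrier[of N E F]
  by (intro l2_op_norm_le) auto

lemma restricted_dft_mult_vec_le:
  assumes v: "v \<in> carrier_vec N" and E: "E \<subseteq> {..<N}" and F: "F \<subseteq> {..<N}"
  shows "l2_norm_vec (restricted_dft N E F *\<^sub>v v)
    \<le> sqrt (real (card F) * (real (card E) / real N)) * l2_norm_vec v"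
proof (rule restricted_dft_schur[OF assms])
  fix j
  have "finite F" using F finite_subset by blast
  thus "card {l \<in> F. nu_hat (real ` E) ((real j - real l) / real N) \<noteq> 0} \<le> card F"
    by (intro card_mono) auto
qed

lemma restricted_dft_norm_nonneg:
  assumes E: "E \<subseteq> {..<N}" and F: "F \<subseteq> {..<N}"
  shows "0 \<le> l2_op_norm (restricted_dft N E F)"
  using restricted_dft_mult_vec_le[OF _ E F] restricted_dft_carrier[of N E F]
  by (intro l2_op_norm_nonneg) auto

text \<open>The norm of a Gram matrix dominates the Euclidean norm of each of its columns, here of the part of
  column \<open>b\<close> with indices in \<open>X\<close>. The proof pairs the image of the conjugated column \<open>v\<close>
  with the image of the unit vector \<open>w\<close> at \<open>b\<close>.\<close>

lemma restricted_dft_norm_ge: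
  assumes E: "E \<subseteq> {..<N}" and F: "F \<subseteq> {..<N}" and X: "X \<subseteq> F" and b: "b \<in> F"
  shows "real (card E) / real N * sqrt (\<Sum>x\<in>X. (norm (nu_hat (real ` E) ((real x - real b) / real N)))\<^sup>2)
    \<le> (l2_op_norm (restricted_dft N E F))\<^sup>2"
proof -
  define T where "T = restricted_dft N E F"
  define h where "h = (\<lambda>x. nu_hat (real ` E) ((real x - real b) / real N))"
  define S where "S = (\<Sum>x\<in>X. (norm (h x))\<^sup>2)"
  define v where "v = vec N (\<lambda>x. if x \<in> X then cnj (h x) else 0)"
  define w where "w = (unit_vec N b :: complex vec)"
  have finF: "finite F" using F finite_subset by blast
  have finX: "finite X" using X finF finite_subset by blast
  have S0: "S \<ge> 0" by (simp add: S_def sum_nonneg)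
  have v: "v \<in> carrier_vec N" and w: "w \<in> carrier_vec N"
    by (simp_all add: v_def w_def)
  have colT: "dim_col T = N" and rowT: "dim_row T = N"
    using restricted_dft_carrier[of N E F] by (auto simp: T_def)
  have bound: "l2_norm_vec (T *\<^sub>v u) \<le> l2_op_norm T * l2_norm_vec u" if "u \<in> carrier_vec N" for u
    using restricted_dft_mult_vec_le[OF _ E F] that colT
    by (intro l2_norm_mult_vec_le) (auto simp: T_def)
  have norm_v: "l2_norm_vec v = sqrt S"
  proof -
    have "(\<Sum>i<N. (cmod (vec_index v i))\<^sup>2) = (\<Sum>i<N. if i \<in> X then (norm (h i))\<^sup>2 else 0)"
      by (intro sum.cong) (auto simp: v_def)
    also have "\<dots> = (\<Sum>i\<in>{..<N} \<inter> X. (norm (h i))\<^sup>2)"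
      by (simp add: sum.inter_restrict)
    also have "{..<N} \<inter> X = X" using X F by auto
    finally show ?thesis
      using v by (simp add: l2_norm_vec_def L2_set_def S_def)
  qed
  have bN: "b < N" using b F by auto
  have norm_w: "l2_norm_vec w = 1"
  proof -
    have "(\<Sum>i<N. (cmod (vec_index w i))\<^sup>2) = (\<Sum>i<N. if i = b then 1 else 0)"
      using bN by (intro sum.cong) (auto simp: w_def)
    thus ?thesis using bN by (simp add: l2_norm_vec_def L2_set_def w_def)
  qed
  have "(\<Sum>j\<in>F. \<Sum>l\<in>F. vec_index v j * cnj (vec_index w l) * nu_hat (real ` E) ((real j - real l) / real N))
    = (\<Sum>j\<in>F. if j \<in> X then of_real ((norm (h j))\<^sup>2) else 0)"
  proof (rule sum.cong[OF refl])
    fix j assume "j \<in> F"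
    hence j: "j < N" using F by auto
    have "(\<Sum>l\<in>F. vec_index v j * cnj (vec_index w l) * nu_hat (real ` E) ((real j - real l) / real N))
      = (\<Sum>l\<in>F. if l = b then vec_index v j * h j else 0)"
      using F bN by (intro sum.cong) (auto simp: w_def h_def)
    also have "\<dots> = vec_index v j * h j" using b finF by simp
    also have "\<dots> = (if j \<in> X then of_real ((norm (h j))\<^sup>2) else 0)"
      using j unfolding complex_norm_square by (simp add: v_def mult.commute)
    finally show "(\<Sum>l\<in>F. vec_index v j * cnj (vec_index w l) * nu_hat (real ` E) ((real j - real l) / real N))
      = (if j \<in> X then of_real ((norm (h j))\<^sup>2) else 0)" .
  qed
  also have "\<dots> = (\<Sum>j\<in>F \<inter> X. of_real ((norm (h j))\<^sup>2))"
    by (simp only: sum.inter_restrict[OF finF])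
  also have "F \<inter> X = X" using X by auto
  finally have "(\<Sum>i<N. vec_index (T *\<^sub>v v) i * cnj (vec_index (T *\<^sub>v w) i))
      = of_real (real (card E) / real N * S)"
    unfolding T_def restricted_dft_inner[OF v w E F] by (simp add: S_def)
  hence "real (card E) / real N * S = norm (\<Sum>i<N. vec_index (T *\<^sub>v v) i * cnj (vec_index (T *\<^sub>v w) i))"
    using S0 by (simp only: norm_of_real) simp
  also have "\<dots> \<le> l2_norm_vec (T *\<^sub>v v) * l2_norm_vec (T *\<^sub>v w)"
    using rowT by (intro norm_inner_le_l2_norm_vec) auto
  also have "\<dots> \<le> (l2_op_norm T * sqrt S) * l2_op_norm T"
    using bound[OF v] bound[OF w] norm_v norm_w l2_norm_vec_nonneg
    by (intro mult_mono) (auto intro: order_trans[OF l2_norm_vec_nonneg])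
  also have "real (card E) / real N * S = (real (card E) / real N * sqrt S) * sqrt S"
    using S0 by (simp add: mult.assoc)
  finally have *: "(real (card E) / real N * sqrt S) * sqrt S \<le> (l2_op_norm T)\<^sup>2 * sqrt S"
    by (simp add: power2_eq_square mult_ac)
  have "real (card E) / real N * sqrt S \<le> (l2_op_norm T)\<^sup>2"
  proof (cases "S = 0")
    case False
    hence "sqrt S > 0" using S0 by simp
    thus ?thesis using * by (rule mult_right_le_imp_le[rotated])
  qed simp
  thus ?thesis by (simp add: S_def h_def T_def)
qed

section \<open>Almost orthogonal columns\<close>

locale digit_pair = A: digit_alphabet M A + B: digit_alphabet M B
  for M :: nat and A B :: "nat set"
begin

abbreviation transform_norm :: "nat \<Rightarrow> real" where
  "transform_norm k \<equiv> l2_op_norm (restricted_dft (M ^ k) (digit_set M A k) (digit_set M B k))"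

lemma density_eq:
  "real (card (digit_set M A k)) / real (M ^ k) = (real (card A) / real M) ^ k"
  by (simp add: A.card_digit_set power_divide)

lemma transform_norm_le:
  assumes "\<And>b. b \<in> digit_set M B k \<Longrightarrow>
    card {b' \<in> digit_set M B k. A.digit_hat k (real b - real b') \<noteq> 0} \<le> K"
  shows "transform_norm k \<le> sqrt (real K * (real (card A) / real M) ^ k)"
  using restricted_dft_norm_le[OF A.digit_set_subset B.digit_set_subset, of k K] assms
  unfolding density_eq A.digit_hat_def by blast

lemma transform_norm_ge:
  assumes "X \<subseteq> digit_set M B k" "b \<in> digit_set M B k"
  shows "(real (card A) / real M) ^ k * sqrt (\<Sum>x\<in>X. (norm (A.digit_hat k (real x - real b)))\<^sup>2)
    \<le> (transform_norm k)\<^sup>2"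
  using restricted_dft_norm_ge[OF A.digit_set_subset B.digit_set_subset assms]
  unfolding density_eq A.digit_hat_def .

lemma transform_norm_nonneg: "0 \<le> transform_norm k"
  by (rule restricted_dft_norm_nonneg[OF A.digit_set_subset B.digit_set_subset])

lemma transform_norm_ge_density: "(real (card A) / real M) ^ k \<le> (transform_norm k)\<^sup>2"
proof -
  obtain b where "b \<in> digit_set M B k" using B.digit_set_nonempty by blast
  thus ?thesis using transform_norm_ge[of "{b}" k b] by (simp add: A.digit_hat_at_0)
qed

text \<open>Let \<open>i\<close> be the lowest position where the digits of \<open>b\<close> and \<open>b'\<close> differ. Modulo \<open>1\<close>, the
  factors of \<open>digit_hat\<close> at \<open>M ^ (i + 1)\<close> and \<open>M ^ (i + 2)\<close> see only the digits at positions
  \<open>i\<close> and \<open>i + 1\<close>, and the hypothesis makes one of them vanish. The second of these factors is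
  present only if \<open>i\<close> is not the top position, which is why the top digit stays free.\<close>

lemma digit_hat_nonzero_imp_mod_eq:
  assumes cond: "\<And>b1 b1' b2 b2'. b1 \<in> B \<Longrightarrow> b1' \<in> B \<Longrightarrow> b1 \<noteq> b1' \<Longrightarrow> b2 \<in> B \<Longrightarrow> b2' \<in> B \<Longrightarrow>
       nu_hat (real ` A) ((real b1 - real b1') / real M) = 0 \<or>
       nu_hat (real ` A) ((real b1 - real b1') / real (M ^ 2) + (real b2 - real b2') / real M) = 0"
    and "b \<in> digit_set M B (Suc k)" "b' \<in> digit_set M B (Suc k)"
    and "A.digit_hat (Suc k) (real b - real b') \<noteq> 0"
  shows "b mod M ^ k = b' mod M ^ k"
  using assms(2-)
proof (induction k arbitrary: b b')
  case (Suc k)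
  have M: "M > 0" by (rule A.base_pos)
  obtain b1 c where b: "b1 \<in> B" "c \<in> digit_set M B (Suc k)" "b = b1 + M * c"
    using Suc.prems(1) by (rule digit_set_Suc_cases)
  obtain b1' c' where b': "b1' \<in> B" "c' \<in> digit_set M B (Suc k)" "b' = b1' + M * c'"
    using Suc.prems(2) by (rule digit_set_Suc_cases)
  obtain b2 e where c: "b2 \<in> B" "e \<in> digit_set M B k" "c = b2 + M * e"
    using b(2) by (rule digit_set_Suc_cases)
  obtain b2' e' where c': "b2' \<in> B" "e' \<in> digit_set M B k" "c' = b2' + M * e'"
    using b'(2) by (rule digit_set_Suc_cases)
  define t where "t = real b - real b'"
  have split1: "A.digit_hat (Suc (Suc k)) t = A.digit_hat (Suc k) (t / real M) * nu_hat (real ` A) (t / real M)"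
    using A.digit_hat_add[of "Suc k" "Suc 0" t] by (simp add: A.digit_hat_1)
  have split2: "A.digit_hat (Suc k) (t / real M) =
      A.digit_hat k (t / real M / real M) * nu_hat (real ` A) (t / real M / real M)"
    using A.digit_hat_add[of k "Suc 0" "t / real M"] by (simp add: A.digit_hat_1)
  have "t / real M = (real b1 - real b1') / real M + of_int (int c - int c')"
    using M by (simp add: t_def b b' field_simps)
  hence first: "nu_hat (real ` A) (t / real M) = nu_hat (real ` A) ((real b1 - real b1') / real M)"
    by (simp only: nu_hat_add_int)
  have "t / real M / real M =
      ((real b1 - real b1') / real (M ^ 2) + (real b2 - real b2') / real M) + of_int (int e - int e')"
    using M by (simp add: t_def b b' c c' field_simps power2_eq_square)
  hence second: "nu_hat (real ` A) (t / real M / real M) =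
      nu_hat (real ` A) ((real b1 - real b1') / real (M ^ 2) + (real b2 - real b2') / real M)"
    by (simp only: nu_hat_add_int)
  have nz: "nu_hat (real ` A) (t / real M) \<noteq> 0" "nu_hat (real ` A) (t / real M / real M) \<noteq> 0"
    "A.digit_hat (Suc k) (t / real M) \<noteq> 0"
    using Suc.prems(3) unfolding t_def[symmetric] split1 split2 by auto
  have eq1: "b1 = b1'"
    using cond[OF b(1) b'(1) _ c(1) c'(1)] nz(1,2) unfolding first second by blast
  have "t / real M = real c - real c'"
    using M by (simp add: t_def b b' eq1 field_simps)
  hence "c mod M ^ k = c' mod M ^ k"
    using nz(3) b(2) b'(2) by (intro Suc.IH) auto
  hence "M * c mod (M * M ^ k) = M * c' mod (M * M ^ k)"
    by (simp only: mult_mod_right[symmetric])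
  hence "(b1 + M * c) mod M ^ Suc k = (b1 + M * c') mod M ^ Suc k"
    by (simp only: power_Suc) (metis mod_add_right_eq)
  thus ?case by (simp only: b(3) b'(3) eq1)
qed simp

text \<open>Numbers that can differ only in their top digit come in groups of at most \<open>card B\<close>, so Schur's
  test loses a factor that does not depend on \<open>k\<close>.\<close>

lemma transform_norm_le_of_condition:
  assumes cond: "\<And>b1 b1' b2 b2'. b1 \<in> B \<Longrightarrow> b1' \<in> B \<Longrightarrow> b1 \<noteq> b1' \<Longrightarrow> b2 \<in> B \<Longrightarrow> b2' \<in> B \<Longrightarrow>
       nu_hat (real ` A) ((real b1 - real b1') / real M) = 0 \<or>
       nu_hat (real ` A) ((real b1 - real b1') / real (M ^ 2) + (real b2 - real b2') / real M) = 0"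
    and "k \<ge> 1"
  shows "transform_norm k \<le> sqrt (real (card B) * (real (card A) / real M) ^ k)"
proof (rule transform_norm_le)
  fix b assume b: "b \<in> digit_set M B k"
  obtain l where k: "k = Suc l" using \<open>k \<ge> 1\<close> by (cases k) auto
  have fin: "finite B" using B.digits_less finite_subset by blast
  have top: "x div M ^ l \<in> B" if "x \<in> digit_set M B k" for x
  proof -
    have "x \<in> digit_set M B (l + Suc 0)" using that by (simp add: k)
    then obtain y z where "y \<in> digit_set M B l" "z \<in> B" "x = y + M ^ l * z"
      unfolding digit_set_add by auto
    thus ?thesis using B.digit_set_less[of y l] B.base_pos by simp
  qed
  define G where "G = {b' \<in> digit_set M B k. A.digit_hat k (real b - real b') \<noteq> 0}"
  have "inj_on (\<lambda>x. x div M ^ l) G"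
  proof (rule inj_onI)
    fix x y assume xy: "x \<in> G" "y \<in> G" and eq: "x div M ^ l = y div M ^ l"
    have "b mod M ^ l = z mod M ^ l" if "z \<in> G" for z
      using digit_hat_nonzero_imp_mod_eq[OF cond, of b l z] that b by (simp add: G_def k)
    hence "x mod M ^ l = y mod M ^ l" using xy by metis
    with eq show "x = y" by (metis div_mod_decomp)
  qed
  moreover have "(\<lambda>x. x div M ^ l) ` G \<subseteq> B" using top by (auto simp: G_def)
  ultimately show "card {b' \<in> digit_set M B k. A.digit_hat k (real b - real b') \<noteq> 0} \<le> card B"
    using fin unfolding G_def by (rule card_inj_on_le)
qed

lemma transform_norm_le_trivial: "transform_norm k \<le> sqrt (real (card B ^ k) * (real (card A) / real M) ^ k)"
proof (rule transform_norm_le)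
  fix b
  have "card {b' \<in> digit_set M B k. A.digit_hat k (real b - real b') \<noteq> 0} \<le> card (digit_set M B k)"
    by (intro card_mono B.finite_digit_set) auto
  thus "card {b' \<in> digit_set M B k. A.digit_hat k (real b - real b') \<noteq> 0} \<le> card B ^ k"
    by (simp add: B.card_digit_set)
qed

end

section \<open>Growth of the norms when the condition fails\<close>

context digit_pair
begin

text \<open>Write \<open>d1\<close> and \<open>d2\<close> for the two digit differences. The candidates for the surviving
  difference are \<open>d1\<close> alone and \<open>d1 + M * d2\<close>. Apart from the two values assumed to be nonzero,
  all arguments at which the transform has to be nonzero are so small that they cannot be zeros,
  with one exception for each candidate: \<open>d1 / M\<^sup>2\<close> for the first and
  \<open>(d1 + M * d2) / M\<^sup>3\<close> for the second. Both have modulus at most \<open>1 / M\<close>, and they have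
  different moduli because \<open>M\<close> does not divide \<open>d1\<close>; so they are not both zeros, and one
  candidate survives.\<close>

lemma surviving_difference:
  assumes "M \<ge> 2" "1 < card A"
    and b1: "b1 \<in> B" "b1' \<in> B" "b1 \<noteq> b1'" and b2: "b2 \<in> B" "b2' \<in> B"
    and first: "nu_hat (real ` A) ((real b1 - real b1') / real M) \<noteq> 0"
    and second: "nu_hat (real ` A) ((real b1 - real b1') / real (M ^ 2) + (real b2 - real b2') / real M) \<noteq> 0"
  obtains \<beta> \<beta>' where "\<beta> \<in> digit_set M B 2" "\<beta>' \<in> digit_set M B 2" "\<beta> \<noteq> \<beta>'"
    "\<And>r. r \<ge> 1 \<Longrightarrow> nu_hat (real ` A) ((real \<beta> - real \<beta>') / real (M ^ r)) \<noteq> 0"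
proof -
  have M: "real M > 0" using A.base_pos by simp
  have two_digits: "x + M * y \<in> digit_set M B 2" if "x \<in> B" "y \<in> B" for x y
    using digit_set_addI[of x M B "Suc 0" y "Suc 0"] that by (simp add: numeral_2_eq_2)
  have differ: "b1 + M * x \<noteq> b1' + M * y" for x y
  proof
    assume "b1 + M * x = b1' + M * y"
    hence "(b1 + M * x) mod M = (b1' + M * y) mod M" by (simp only:)
    moreover have "b1 < M" "b1' < M" using b1 B.digits_less by auto
    ultimately show False using b1 by simp
  qed
  have first': "nu_hat (real ` A) ((real (b1 + M * x) - real (b1' + M * y)) / real (M ^ 1)) \<noteq> 0" for x y
  proof -
    have "(real (b1 + M * x) - real (b1' + M * y)) / real (M ^ 1)
        = (real b1 - real b1') / real M + of_int (int x - int y)"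
      using M by (simp add: field_simps)
    thus ?thesis using first by (simp only: nu_hat_add_int not_False_eq_True)
  qed
  have split: "(real (b1 + M * x) - real (b1' + M * y)) / real (M ^ 2)
        = (real b1 - real b1') / real (M ^ 2) + (real x - real y) / real M" for x y
      using M by (simp add: field_simps power2_eq_square)
  have small: "\<bar>(real x - real y) / real (M ^ (l + r))\<bar> \<le> 1 / real M ^ r"
    if "x \<in> digit_set M B l" "y \<in> digit_set M B l" for x y l r
  proof -
    have "real x < real M ^ l" "real y < real M ^ l"
      using B.digit_set_less[OF that(1)] B.digit_set_less[OF that(2)]
      by (simp_all flip: of_nat_power)
    hence "\<bar>real x - real y\<bar> \<le> real M ^ l" by linarith
    thus ?thesis using M by (simp add: field_simps power_add)
  qed
  have tail: "nu_hat (real ` A) ((real x - real y) / real (M ^ (l + r))) \<noteq> 0"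
    if "x \<in> digit_set M B l" "y \<in> digit_set M B l" "r \<ge> 2" for x y l r
  proof (rule nu_hat_nonzero_if_small[OF A.digits_less A.nonempty])
    have "2 * real M \<le> real M * real M" using \<open>M \<ge> 2\<close> by simp
    also have "\<dots> \<le> real M ^ r"
      using power_increasing[of 2 r "real M"] that(3) \<open>M \<ge> 2\<close> by (simp add: power2_eq_square)
    finally have "1 / real M ^ r \<le> 1 / (2 * real M)"
      using M by (intro divide_left_mono) auto
    thus "\<bar>(real x - real y) / real (M ^ (l + r))\<bar> \<le> 1 / (2 * real M)"
      using small[OF that(1,2), of r] by linarith
  qed
  show ?thesis
  proof (cases "nu_hat (real ` A) ((real b1 - real b1') / real (M ^ 2)) = 0")
    case False
    show ?thesis
    proof (rule that[of "b1 + M * b2" "b1' + M * b2"])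
      fix r :: nat assume "r \<ge> 1"
      then consider "r = 1" | "r = 2" | "r \<ge> 3" by linarith
      thus "nu_hat (real ` A) ((real (b1 + M * b2) - real (b1' + M * b2)) / real (M ^ r)) \<noteq> 0"
      proof cases
        case 1 show ?thesis unfolding 1 by (rule first')
      next
        case 2 thus ?thesis using False by simp
      next
        case 3 thus ?thesis using tail[of b1 "Suc 0" b1' "r - 1"] b1 by simp
      qed
    qed (use b1 b2 two_digits differ in auto)
  next
    case True
    define \<beta> \<beta>' where "\<beta> = b1 + M * b2" and "\<beta>' = b1' + M * b2'"
    have \<beta>: "\<beta> \<in> digit_set M B 2" "\<beta>' \<in> digit_set M B 2"
      using two_digits b1 b2 by (auto simp: \<beta>_def \<beta>'_def)
    have third: "nu_hat (real ` A) ((real \<beta> - real \<beta>') / real (M ^ 3)) \<noteq> 0"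
    proof
      assume "nu_hat (real ` A) ((real \<beta> - real \<beta>') / real (M ^ 3)) = 0"
      hence "\<bar>(real b1 - real b1') / real (M ^ 2)\<bar> = \<bar>(real \<beta> - real \<beta>') / real (M ^ 3)\<bar>"
        using small[of b1 "Suc 0" b1' 1] small[OF \<beta>, of 1] b1 True
        by (intro small_nu_hat_zeros_unique[OF A.digits_less assms(2)])
           (simp_all add: numeral_2_eq_2 numeral_3_eq_3)
      hence "real M * \<bar>real b1 - real b1'\<bar> = \<bar>real \<beta> - real \<beta>'\<bar>"
        using M by (simp add: abs_mult field_simps power2_eq_square power3_eq_cube)
      hence "\<bar>real M * (real b1 - real b1')\<bar> = \<bar>real \<beta> - real \<beta>'\<bar>"
        by (simp only: abs_mult abs_of_nat)
      hence "real M * (real b1 - real b1') = real \<beta> - real \<beta>' \<or>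
          real M * (real b1 - real b1') = real \<beta>' - real \<beta>"
        by linarith
      hence "real (b1 + M * (b2 + b1')) = real (b1' + M * (b2' + b1)) \<or>
          real (b1 + M * (b2 + b1)) = real (b1' + M * (b2' + b1'))"
        by (auto simp: \<beta>_def \<beta>'_def algebra_simps)
      thus False using differ by (simp only: of_nat_eq_iff) blast
    qed
    show ?thesis
    proof (rule that[of \<beta> \<beta>'])
      fix r :: nat assume "r \<ge> 1"
      then consider "r = 1" | "r = 2" | "r = 3" | "r \<ge> 4" by linarith
      thus "nu_hat (real ` A) ((real \<beta> - real \<beta>') / real (M ^ r)) \<noteq> 0"
      proof cases
        case 1 show ?thesis unfolding 1 \<beta>_def \<beta>'_def by (rule first')
      next
        case 2 show ?thesis using second unfolding 2 \<beta>_def \<beta>'_def split .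
      next
        case 3 thus ?thesis using third by simp
      next
        case 4
        hence "2 + (r - 2) = r" "r - 2 \<ge> 2" by simp_all
        thus ?thesis using tail[OF \<beta>, of "r - 2"] by metis
      qed
    qed (use \<beta> differ in \<open>auto simp: \<beta>_def \<beta>'_def\<close>)
  qed
qed

text \<open>Numbers are built from blocks of \<open>m\<close> digits, each block being \<open>\<gamma>\<close> or \<open>\<gamma>'\<close>, and are compared
  with the number \<open>b\<close> all of whose blocks are \<open>\<gamma>'\<close>. A new top block leaves the earlier factors
  unchanged by periodicity. It contributes \<open>digit_hat m\<close> at \<open>y\<close> if it is \<open>\<gamma>'\<close>, and at
  \<open>d + y\<close> if it is \<open>\<gamma>\<close>, where \<open>y\<close> is the influence of the blocks below. Since \<open>\<gamma>\<close> and
  \<open>\<gamma>'\<close> differ only in their lowest \<open>q\<close> digits, \<open>y\<close> is as small as desired once \<open>m\<close> is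
  large. The first choice then has weight close to \<open>1\<close> and the second has weight at least about
  \<open>c\<^sup>2\<close>, with \<open>c\<close> independent of \<open>m\<close>; together they exceed \<open>1\<close>, so every block multiplies the
  sum by more than a fixed factor larger than \<open>1\<close>.\<close>

lemma column_growth:
  assumes "M \<ge> 2"
    and \<beta>: "\<beta> \<in> digit_set M B q" "\<beta>' \<in> digit_set M B q" "\<beta> \<noteq> \<beta>'"
    and nz: "\<And>r. r \<ge> 1 \<Longrightarrow> nu_hat (real ` A) ((real \<beta> - real \<beta>') / real (M ^ r)) \<noteq> 0"
  obtains m \<mu> where "m \<ge> 1" "\<mu> > 1"
    "\<forall>L. \<exists>X b. X \<subseteq> digit_set M B (m * L) \<and> b \<in> digit_set M B (m * L) \<and>
       \<mu> ^ L \<le> (\<Sum>x\<in>X. (norm (A.digit_hat (m * L) (real x - real b)))\<^sup>2)"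
proof -
  define d where "d = real \<beta> - real \<beta>'"
  obtain c p where c: "c > 0" and p: "\<And>k. k \<ge> p \<Longrightarrow> c \<le> norm (A.digit_hat k d)"
    unfolding d_def using A.digit_hat_bounded_below[OF \<open>M \<ge> 2\<close> nz] by metis
  have c1: "c \<le> 1" using p[of p] A.norm_digit_hat_le_1[of p d] by simp
  have d1: "\<bar>d\<bar> \<ge> 1" using \<open>\<beta> \<noteq> \<beta>'\<close> by (auto simp: d_def abs_if)
  have Mpos: "real M > 0" using \<open>M \<ge> 2\<close> by simp
  obtain m0 where "32 * pi * \<bar>d\<bar> / c\<^sup>2 < real M ^ m0"
    using real_arch_pow[of "real M"] \<open>M \<ge> 2\<close> by auto
  define m where "m = Max {m0, p, q, 1}"
  have m: "m \<ge> m0" "m \<ge> p" "m \<ge> q" "m \<ge> 1" by (simp_all add: m_def)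
  \<comment> \<open>The bound kept for \<open>y\<close>: the blocks below can differ by at most \<open>\<eta> * M ^ (m * L)\<close>, a
     property that survives the addition of a block because \<open>\<eta> + \<bar>d\<bar> \<le> 2 * \<bar>d\<bar>\<close>. The
     constant \<open>32\<close> leaves \<open>8 * pi * \<eta> \<le> c\<^sup>2 / 2\<close>, which is the loss in the two weights.\<close>
  define \<eta> where "\<eta> = 2 * \<bar>d\<bar> / real M ^ m"
  have "32 * pi * \<bar>d\<bar> / c\<^sup>2 < real M ^ m"
    using \<open>32 * pi * \<bar>d\<bar> / c\<^sup>2 < real M ^ m0\<close> power_increasing[OF m(1), of "real M"] \<open>M \<ge> 2\<close> by linarith
  hence \<eta>: "16 * pi * \<eta> \<le> c\<^sup>2"
    using c Mpos by (simp add: \<eta>_def field_simps)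
  have \<eta>0: "\<eta> \<ge> 0" by (simp add: \<eta>_def)
  have c2: "c\<^sup>2 \<le> c" using c c1 by (simp add: power2_eq_square mult_left_le)
  have "16 * \<eta> \<le> 16 * pi * \<eta>" using \<eta>0 pi_ge_two by (simp add: mult_right_mono)
  hence \<eta>1: "\<eta> \<le> 1" using \<eta> c2 c1 by linarith
  have pi\<eta>0: "0 \<le> pi * \<eta>" using \<eta>0 by simp
  have pi\<eta>: "16 * (pi * \<eta>) \<le> c" "16 * (pi * \<eta>) \<le> 1" using \<eta> c2 c1 by simp_all
  define \<mu> where "\<mu> = 1 + c\<^sup>2 / 2"
  obtain t where t: "t \<in> digit_set M B (m - q)" using B.digit_set_nonempty by blast
  define \<gamma> \<gamma>' where "\<gamma> = \<beta> + M ^ q * t" and "\<gamma>' = \<beta>' + M ^ q * t"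
  have \<gamma>: "\<gamma> \<in> digit_set M B m" "\<gamma>' \<in> digit_set M B m"
    using digit_set_addI[OF \<beta>(1) t] digit_set_addI[OF \<beta>(2) t] m by (simp_all add: \<gamma>_def \<gamma>'_def)
  have \<gamma>_diff: "real \<gamma> - real \<gamma>' = d" by (simp add: \<gamma>_def \<gamma>'_def d_def)
  have block: "\<mu> \<le> (norm (A.digit_hat m y))\<^sup>2 + (norm (A.digit_hat m (d + y)))\<^sup>2"
    if "\<bar>y\<bar> \<le> \<eta>" for y
  proof -
    have y: "2 * pi * \<bar>y\<bar> \<le> 2 * (pi * \<eta>)" using that by simp
    have "norm (A.digit_hat m 0 - A.digit_hat m y) \<le> 2 * pi * \<bar>y\<bar>"
      using A.norm_digit_hat_diff_le[of m 0 y] by simp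
    hence 1: "1 - 2 * (pi * \<eta>) \<le> norm (A.digit_hat m y)"
      using norm_triangle_ineq2[of "A.digit_hat m 0" "A.digit_hat m y"] y
      unfolding A.digit_hat_at_0 norm_one by linarith
    have "norm (A.digit_hat m d - A.digit_hat m (d + y)) \<le> 2 * pi * \<bar>y\<bar>"
      using A.norm_digit_hat_diff_le[of m d "d + y"] by simp
    hence 2: "c - 2 * (pi * \<eta>) \<le> norm (A.digit_hat m (d + y))"
      using norm_triangle_ineq2[of "A.digit_hat m d" "A.digit_hat m (d + y)"] y p[OF m(2)] by linarith
    have "1 - 4 * (pi * \<eta>) \<le> (1 - 2 * (pi * \<eta>))\<^sup>2"
      by (simp add: power2_eq_square algebra_simps)
    also have "\<dots> \<le> (norm (A.digit_hat m y))\<^sup>2"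
      using 1 pi\<eta> \<eta>0 by (intro power_mono) auto
    finally have 3: "1 - 4 * (pi * \<eta>) \<le> (norm (A.digit_hat m y))\<^sup>2" .
    have "2 * c * (2 * (pi * \<eta>)) \<le> 4 * (pi * \<eta>)"
      using mult_right_mono[OF c1, of "4 * (pi * \<eta>)"] \<eta>0 by simp
    hence "c\<^sup>2 - 4 * (pi * \<eta>) \<le> (c - 2 * (pi * \<eta>))\<^sup>2"
      using zero_le_power2[of "2 * (pi * \<eta>)"] unfolding power2_diff by linarith
    also have "\<dots> \<le> (norm (A.digit_hat m (d + y)))\<^sup>2"
      using 2 pi\<eta> pi\<eta>0 by (intro power_mono) linarith+
    finally show ?thesis using 3 \<eta> by (simp add: \<mu>_def)
  qed
  have grow: "\<exists>X b. X \<subseteq> digit_set M B (m * L) \<and> b \<in> digit_set M B (m * L) \<and>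
       (\<forall>x\<in>X. \<bar>real x - real b\<bar> \<le> \<eta> * real (M ^ (m * L))) \<and>
       \<mu> ^ L \<le> (\<Sum>x\<in>X. (norm (A.digit_hat (m * L) (real x - real b)))\<^sup>2)" for L
  proof (induction L)
    case 0
    show ?case by (intro exI[of _ "{0}"] exI[of _ 0]) (simp add: \<eta>0)
  next
    case (Suc L)
    then obtain X b where X: "X \<subseteq> digit_set M B (m * L)" and b: "b \<in> digit_set M B (m * L)"
      and close: "\<And>x. x \<in> X \<Longrightarrow> \<bar>real x - real b\<bar> \<le> \<eta> * real (M ^ (m * L))"
      and sum: "\<mu> ^ L \<le> (\<Sum>x\<in>X. (norm (A.digit_hat (m * L) (real x - real b)))\<^sup>2)"
      by blast
    define N where "N = M ^ (m * L)"
    have N: "real N > 0" using Mpos by (simp add: N_def)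
    define b' where "b' = b + N * \<gamma>'"
    define w where "w = (\<lambda>x. (norm (A.digit_hat (m * L) (real x - real b)))\<^sup>2)"
    define w' where "w' = (\<lambda>x. (norm (A.digit_hat (m * Suc L) (real x - real b')))\<^sup>2)"
    have finX: "finite X" using X B.finite_digit_set finite_subset by blast
    have less: "x < N" if "x \<in> X" for x
      using X that B.digit_set_less unfolding N_def by blast
    have in_next: "x + N * g \<in> digit_set M B (m * Suc L)"
      if "x \<in> digit_set M B (m * L)" "g \<in> digit_set M B m" for x g
      using digit_set_addI[OF that] by (simp add: N_def add.commute)
    have split: "A.digit_hat (m * Suc L) (real (x + N * g) - real b') =
       A.digit_hat m ((real g - real \<gamma>') + (real x - real b) / real N) * A.digit_hat (m * L) (real x - real b)"
      for x g
    proof -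
      have eq: "real (x + N * g) - real b' = (real x - real b) + of_int (int g - int \<gamma>') * real (M ^ (m * L))"
        by (simp add: b'_def N_def algebra_simps)
      have "A.digit_hat (m * L) (real (x + N * g) - real b') = A.digit_hat (m * L) (real x - real b)"
        unfolding eq by (rule A.digit_hat_periodic)
      moreover have "(real (x + N * g) - real b') / real N = (real g - real \<gamma>') + (real x - real b) / real N"
        using N by (simp add: b'_def field_simps)
      ultimately show ?thesis
        using A.digit_hat_add[of m "m * L" "real (x + N * g) - real b'"] by (simp add: N_def)
    qed
    define X' where "X' = (\<lambda>x. x + N * \<gamma>') ` X \<union> (\<lambda>x. x + N * \<gamma>) ` X"
    have neq: "\<gamma>' \<noteq> \<gamma>" using \<gamma>_diff d1 by auto
    have disj: "(\<lambda>x. x + N * \<gamma>') ` X \<inter> (\<lambda>x. x + N * \<gamma>) ` X = {}"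
    proof (rule ccontr)
      assume "(\<lambda>x. x + N * \<gamma>') ` X \<inter> (\<lambda>x. x + N * \<gamma>) ` X \<noteq> {}"
      then obtain x y where xy: "x \<in> X" "y \<in> X" and eq: "x + N * \<gamma>' = y + N * \<gamma>" by blast
      from eq have "(x + N * \<gamma>') div N = (y + N * \<gamma>) div N" by (simp only:)
      thus False using less[OF xy(1)] less[OF xy(2)] neq by simp
    qed
    have "\<mu> ^ Suc L \<le> (\<Sum>x\<in>X. \<mu> * w x)"
      unfolding power_Suc sum_distrib_left[symmetric] w_def
      using sum by (rule mult_left_mono) (simp add: \<mu>_def)
    also have "\<dots> \<le> (\<Sum>x\<in>X. w' (x + N * \<gamma>') + w' (x + N * \<gamma>))"
    proof (rule sum_mono)
      fix x assume x: "x \<in> X"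
      have "\<bar>(real x - real b) / real N\<bar> \<le> \<eta>"
        using close[OF x] N by (simp add: N_def field_simps)
      hence "\<mu> * w x \<le> ((norm (A.digit_hat m ((real x - real b) / real N)))\<^sup>2 +
          (norm (A.digit_hat m (d + (real x - real b) / real N)))\<^sup>2) * w x"
        by (intro mult_right_mono block) (simp_all add: w_def)
      also have "\<dots> = w' (x + N * \<gamma>') + w' (x + N * \<gamma>)"
        unfolding w'_def split \<gamma>_diff by (simp add: w_def norm_mult power_mult_distrib algebra_simps)
      finally show "\<mu> * w x \<le> w' (x + N * \<gamma>') + w' (x + N * \<gamma>)" .
    qed
    also have "\<dots> = (\<Sum>x\<in>X'. w' x)"
      unfolding X'_def using finX disj
      by (subst sum.union_disjoint) (auto simp: sum.distrib sum.reindex inj_on_def)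
    finally have "\<mu> ^ Suc L \<le> (\<Sum>x\<in>X'. w' x)" .
    moreover have "X' \<subseteq> digit_set M B (m * Suc L)"
      using X \<gamma> in_next by (auto simp: X'_def)
    moreover have "b' \<in> digit_set M B (m * Suc L)"
      using b \<gamma> in_next by (simp add: b'_def)
    moreover have "\<bar>real x - real b'\<bar> \<le> \<eta> * real (M ^ (m * Suc L))" if x': "x \<in> X'" for x
    proof -
      obtain y g where y: "y \<in> X" and g: "g = \<gamma>' \<or> g = \<gamma>" and x: "x = y + N * g"
        using x' by (auto simp: X'_def)
      have "real x - real b' = (real y - real b) + real N * (real g - real \<gamma>')"
        by (simp add: x b'_def algebra_simps)
      hence "\<bar>real x - real b'\<bar> \<le> \<bar>real y - real b\<bar> + real N * \<bar>real g - real \<gamma>'\<bar>"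
        using N by (simp add: abs_mult order_trans[OF abs_triangle_ineq])
      also have "\<bar>real y - real b\<bar> \<le> real N * 1"
        using close[OF y] mult_right_mono[OF \<eta>1, of "real N"] N unfolding N_def by linarith
      also have "\<bar>real g - real \<gamma>'\<bar> \<le> \<bar>d\<bar>" using g \<gamma>_diff by auto
      finally have "\<bar>real x - real b'\<bar> \<le> real N * (1 + \<bar>d\<bar>)"
        using N by (simp add: algebra_simps mult_left_mono)
      also have "\<dots> \<le> real N * (2 * \<bar>d\<bar>)"
        using d1 N by (intro mult_left_mono) auto
      also have "\<dots> = \<eta> * real (M ^ (m * Suc L))"
        using Mpos by (simp add: \<eta>_def N_def power_add)
      finally show ?thesis .
    qed
    ultimately show ?case unfolding w'_def by blast
  qed
  show ?thesis
  proof (rule that[of m \<mu>])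
    show "m \<ge> 1" by (rule m)
    show "\<mu> > 1" using c by (simp add: \<mu>_def)
    show "\<forall>L. \<exists>X b. X \<subseteq> digit_set M B (m * L) \<and> b \<in> digit_set M B (m * L) \<and>
       \<mu> ^ L \<le> (\<Sum>x\<in>X. (norm (A.digit_hat (m * L) (real x - real b)))\<^sup>2)"
      using grow by blast
  qed
qed

end

section \<open>The exponent\<close>

context digit_pair
begin

context
  fixes \<delta> :: real
  assumes cards: "1 < card A" and base: "M \<ge> 2"
    and \<delta>: "\<delta> = ln (real (card A)) / ln (real M)"
begin

definition admissible :: "real \<Rightarrow> bool" where
  "admissible \<beta> \<longleftrightarrow> (\<exists>C>0. \<forall>k\<ge>1. transform_norm k \<le> C * real M powr (- (real k * \<beta>)))"

lemma fup_exponent_eq: "fup_exponent M A B = Sup {\<beta>. admissible \<beta>}"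
  by (simp add: fup_exponent_def admissible_def restricted_dft_def)

private lemma ln_M_pos: "ln (real M) > 0"
  using base by simp

private lemma ln_density: "ln (real (card A) / real M) = - (1 - \<delta>) * ln (real M)"
  using cards base ln_M_pos by (simp add: ln_div \<delta> field_simps)

private lemma card_B_pos: "card B > 0"
  using B.digits_less B.nonempty finite_subset[of B "{..<M}"] by (simp add: card_gt_0_iff)

private lemma density_pos: "real (card A) / real M > 0"
  using cards base by simp

lemma density_power_powr:
  "sqrt ((real (card A) / real M) ^ k) = real M powr (- (real k * ((1 - \<delta>) / 2)))"
proof -
  have "sqrt ((real (card A) / real M) ^ k) = exp (ln (sqrt ((real (card A) / real M) ^ k)))"
    using density_pos by simp
  also have "ln (sqrt ((real (card A) / real M) ^ k)) = real k * ln (real (card A) / real M) / 2"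
    using density_pos by (simp add: ln_sqrt ln_realpow del: real_sqrt_power)
  also have "exp \<dots> = real M powr (- (real k * ((1 - \<delta>) / 2)))"
    using base unfolding ln_density powr_def by (simp add: field_simps)
  finally show ?thesis .
qed

lemma admissible_if_norm_le:
  assumes "\<And>k. k \<ge> 1 \<Longrightarrow> transform_norm k \<le> sqrt (K * (real (card A) / real M) ^ k)" "K > 0"
  shows "admissible ((1 - \<delta>) / 2)"
  unfolding admissible_def
proof (intro exI[of _ "sqrt K"] conjI allI impI)
  fix k :: nat assume "1 \<le> k"
  thus "transform_norm k \<le> sqrt K * real M powr (- (real k * ((1 - \<delta>) / 2)))"
    using assms(1)[of k] by (simp only: real_sqrt_mult density_power_powr)
qed (use assms in simp)

text \<open>A supremum of reals can be bounded from above by a bound of its members only if there are members.\<close>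

lemma ex_admissible: "\<exists>\<beta>. admissible \<beta>"
proof
  show "admissible (- (1 / 2))"
    unfolding admissible_def
  proof (intro exI[of _ 1] conjI allI impI)
    fix k :: nat
    have le: "card A \<le> M" "card B \<le> M"
      using card_mono[OF _ A.digits_less] card_mono[OF _ B.digits_less] by auto
    have "real (card B) * (real (card A) / real M) \<le> real M * 1"
      using le base by (intro mult_mono) auto
    hence "(real (card B) * (real (card A) / real M)) ^ k \<le> real M ^ k"
      by (intro power_mono) auto
    hence "sqrt (real (card B ^ k) * (real (card A) / real M) ^ k) \<le> sqrt (real M ^ k)"
      by (simp only: of_nat_power power_mult_distrib[symmetric] real_sqrt_le_iff)
    also have "\<dots> = sqrt (real M powr real k)"
      using base by (simp add: powr_realpow)
    also have "\<dots> = real M powr (- (real k * (- (1 / 2))))"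
      using base by (simp add: powr_half_sqrt[symmetric] powr_powr)
    finally show "transform_norm k \<le> 1 * real M powr (- (real k * (- (1 / 2))))"
      using transform_norm_le_trivial[of k] by simp
  qed simp
qed

text \<open>With \<open>\<mu> = 1\<close> this is the general bound on the exponent; growth of the squared
  norm by a factor larger than \<open>1\<close> over the power of the density lowers the bound strictly. Taking logarithms turns the comparison into \<open>L * e \<le> 2 * ln C\<close> for all
  \<open>L\<close>, which forces \<open>e \<le> 0\<close>.\<close>

lemma admissible_le:
  assumes adm: "admissible \<beta>" and "m \<ge> 1" "\<mu> \<ge> 1"
    and lower: "\<And>L. (real (card A) / real M) ^ (m * L) * sqrt (\<mu> ^ L) \<le> (transform_norm (m * L))\<^sup>2"
  shows "\<beta> \<le> (1 - \<delta>) / 2 - ln \<mu> / (4 * real m * ln (real M))"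
proof -
  obtain C where C: "C > 0" and bound: "\<And>k. k \<ge> 1 \<Longrightarrow> transform_norm k \<le> C * real M powr (- (real k * \<beta>))"
    using adm unfolding admissible_def by blast
  define e where "e = real m * ln (real (card A) / real M) + ln \<mu> / 2 + 2 * real m * \<beta> * ln (real M)"
  have e_le: "real L * e \<le> 2 * ln C" if "L \<ge> 1" for L
  proof -
    have mL: "m * L \<ge> 1" using that \<open>m \<ge> 1\<close> by simp
    have pos: "0 < (real (card A) / real M) ^ (m * L) * sqrt (\<mu> ^ L)"
      using density_pos \<open>\<mu> \<ge> 1\<close> by (intro mult_pos_pos) auto
    have "(real (card A) / real M) ^ (m * L) * sqrt (\<mu> ^ L) \<le> (C * real M powr (- (real (m * L) * \<beta>)))\<^sup>2"
      using lower[of L] power_mono[OF bound[OF mL] transform_norm_nonneg, of 2] by linarith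
    hence "ln ((real (card A) / real M) ^ (m * L) * sqrt (\<mu> ^ L)) \<le> ln ((C * real M powr (- (real (m * L) * \<beta>)))\<^sup>2)"
      using pos base C by (subst ln_le_cancel_iff) auto
    also have "ln ((real (card A) / real M) ^ (m * L) * sqrt (\<mu> ^ L)) =
        real (m * L) * ln (real (card A) / real M) + real L * ln \<mu> / 2"
    proof -
      have "sqrt (\<mu> ^ L) > 0" using \<open>\<mu> \<ge> 1\<close> by simp
      hence "ln ((real (card A) / real M) ^ (m * L) * sqrt (\<mu> ^ L)) =
          ln ((real (card A) / real M) ^ (m * L)) + ln (sqrt (\<mu> ^ L))"
        using density_pos by (intro ln_mult_pos) simp_all
      thus ?thesis
        using \<open>\<mu> \<ge> 1\<close> density_pos by (simp add: ln_realpow ln_sqrt del: real_sqrt_power)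
    qed
    also have "ln ((C * real M powr (- (real (m * L) * \<beta>)))\<^sup>2) = 2 * (ln C - real (m * L) * \<beta> * ln (real M))"
      using C base by (simp add: ln_realpow ln_mult_pos ln_powr)
    finally show ?thesis by (simp add: e_def algebra_simps)
  qed
  have "e \<le> 0"
  proof (rule ccontr)
    assume "\<not> e \<le> 0"
    hence "e > 0" by simp
    then obtain L :: nat where L: "2 * ln C < real L * e"
      using reals_Archimedean3 by blast
    have "real L * e \<le> real (Suc L) * e" using \<open>e > 0\<close> by simp
    thus False using e_le[of "Suc L"] L by linarith
  qed
  define q where "q = 4 * real m * ln (real M)"
  have q: "q > 0" using ln_M_pos \<open>m \<ge> 1\<close> by (simp add: q_def)
  have "\<beta> * q \<le> (1 - \<delta>) / 2 * q - ln \<mu>"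
    using \<open>e \<le> 0\<close> unfolding e_def ln_density q_def by (simp add: algebra_simps)
  hence "\<beta> \<le> (1 - \<delta>) / 2 - ln \<mu> / q"
    using q by (simp add: field_simps)
  thus ?thesis by (simp only: q_def)
qed

lemma admissible_le_critical: "admissible \<beta> \<Longrightarrow> \<beta> \<le> (1 - \<delta>) / 2"
  using admissible_le[of \<beta> 1 1] transform_norm_ge_density by simp

lemma fup_exponent_critical_iff:
  "fup_exponent M A B = (1 - \<delta>) / 2 \<longleftrightarrow>
    (\<forall>b1\<in>B. \<forall>b1'\<in>B. b1 \<noteq> b1' \<longrightarrow>
       nu_hat (real ` A) ((real b1 - real b1') / real M) = 0 \<or>
       (\<forall>b2\<in>B. \<forall>b2'\<in>B.
          nu_hat (real ` A) ((real b1 - real b1') / real (M ^ 2) + (real b2 - real b2') / real M) = 0))"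
    (is "?critical \<longleftrightarrow> ?orthogonal")
proof
  assume orth: ?orthogonal
  have "transform_norm k \<le> sqrt (real (card B) * (real (card A) / real M) ^ k)" if "k \<ge> 1" for k
    using orth that by (intro transform_norm_le_of_condition) blast+
  hence "admissible ((1 - \<delta>) / 2)"
    using card_B_pos by (intro admissible_if_norm_le) auto
  thus ?critical
    unfolding fup_exponent_eq using admissible_le_critical by (intro cSup_eq_maximum) auto
next
  assume crit: ?critical
  show ?orthogonal
  proof (rule ccontr)
    assume "\<not> ?orthogonal"
    then obtain b1 b1' b2 b2' where b: "b1 \<in> B" "b1' \<in> B" "b1 \<noteq> b1'" "b2 \<in> B" "b2' \<in> B"
      and "nu_hat (real ` A) ((real b1 - real b1') / real M) \<noteq> 0"
      "nu_hat (real ` A) ((real b1 - real b1') / real (M ^ 2) + (real b2 - real b2') / real M) \<noteq> 0"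
      by blast
    then obtain \<beta> \<beta>' where "\<beta> \<in> digit_set M B 2" "\<beta>' \<in> digit_set M B 2" "\<beta> \<noteq> \<beta>'"
      "\<And>r. r \<ge> 1 \<Longrightarrow> nu_hat (real ` A) ((real \<beta> - real \<beta>') / real (M ^ r)) \<noteq> 0"
      by (rule surviving_difference[OF base cards]) blast
    then obtain m \<mu> where m: "m \<ge> 1" and \<mu>: "\<mu> > 1"
      and growth: "\<forall>L. \<exists>X b. X \<subseteq> digit_set M B (m * L) \<and> b \<in> digit_set M B (m * L) \<and>
         \<mu> ^ L \<le> (\<Sum>x\<in>X. (norm (A.digit_hat (m * L) (real x - real b)))\<^sup>2)"
      by (rule column_growth[OF base]) blast
    have lower: "(real (card A) / real M) ^ (m * L) * sqrt (\<mu> ^ L) \<le> (transform_norm (m * L))\<^sup>2" for L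
    proof -
      obtain X b where X: "X \<subseteq> digit_set M B (m * L)" "b \<in> digit_set M B (m * L)"
        and le: "\<mu> ^ L \<le> (\<Sum>x\<in>X. (norm (A.digit_hat (m * L) (real x - real b)))\<^sup>2)"
        using growth by blast
      have "(real (card A) / real M) ^ (m * L) * sqrt (\<mu> ^ L) \<le> (real (card A) / real M) ^ (m * L) *
          sqrt (\<Sum>x\<in>X. (norm (A.digit_hat (m * L) (real x - real b)))\<^sup>2)"
        by (intro mult_left_mono real_sqrt_le_mono le) simp
      thus ?thesis using transform_norm_ge[OF X] by linarith
    qed
    have "fup_exponent M A B \<le> (1 - \<delta>) / 2 - ln \<mu> / (4 * real m * ln (real M))"
      unfolding fup_exponent_eq using ex_admissible m \<mu> lower
      by (intro cSup_least) (auto intro!: admissible_le)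
    moreover have "ln \<mu> / (4 * real m * ln (real M)) > 0"
      using m \<mu> ln_M_pos by simp
    ultimately show False using crit by linarith
  qed
qed

end

end

theorem theorem1p4:
  fixes M :: nat and A B :: "nat set" and \<delta> :: real
  assumes "M \<ge> 3"
    and "A \<subseteq> {0..M - 1}" and "B \<subseteq> {0..M - 1}"
    and "1 < card A" and "card A = card B" and "card B < M"
    and "\<delta> = ln (real (card A)) / ln (real M)"
  shows "fup_exponent M A B = (1 - \<delta>) / 2 \<longleftrightarrow>
    (\<forall>b1\<in>B. \<forall>b1'\<in>B. b1 \<noteq> b1' \<longrightarrow>
       nu_hat (real ` A) ((real b1 - real b1') / real M) = 0 \<or>
       (\<forall>b2\<in>B. \<forall>b2'\<in>B.
          nu_hat (real ` A) ((real b1 - real b1') / real (M ^ 2) + (real b2 - real b2') / real M) = 0))"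
proof -
  interpret digit_pair M A B
    using assms by unfold_locales auto
  show ?thesis
    using assms by (intro fup_exponent_critical_iff) auto
qed

end
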